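(* Let $q$ be a prime power and $d$ an integer with $d/6$ odd. Let $V'=\mathbb{F}_{q^6}^{d/6}$ with $\kappa'(x,y)=\sum_{i=1}^{d/6}x_iy_i^{q^3}$ and $H'(x)=\kappa'(x,x)$. Fix $\lambda\in\mathbb{F}_{q^6}^*$ with $\lambda+\lambda^{q^3}=0$, and regard $V'$ as a $d$-dimensional $\mathbb{F}_q$-space with the symplectic form $\kappa(x,y)=\mathrm{Tr}_{q^6/q}(\lambda\kappa'(x,y))$ and associated polar space $W(d-1,q)$. Let $\square$ be the set of nonzero squares of $\mathbb{F}_q$, let $\mathcal{T}$ be a $\square$-invariant subset of $\mathbb{F}_{q^3}^*$, let $T$ be a set of $\square$-coset representatives of $\mathcal{T}$, and let $\mathcal{M}=\{\langle v\rangle_{\mathbb{F}_q}:\ H'(v)\in\mathcal{T}\}$. Suppose $\mathcal{M}$ is an $m$-ovoid of $W(d-1,q)$. If $\mathcal{T}$ is $\mathbb{F}_q^*$-invariant, then $|T|\ge q$ if $q$ is even and $|T|\ge 2q$ if $q$ is odd.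
   Context: Points of $W(d-1,q)$ are all 1-dimensional $\mathbb{F}_q$-subspaces; generators are the maximal totally isotropic subspaces; an $m$-ovoid is a set of points meeting every generator in exactly $m$ points. When $q$ is even, $\square=\mathbb{F}_q^*$. *)

theory Defs
  imports "HOL-Analysis.Cartesian_Space" "HOL-Number_Theory.Prime_Powers"
begin

section \<open>Subfields of a finite field\<close>

text \<open>
  The field of order \<open>q^6\<close> is a type \<open>'a :: {field, finite}\<close>. For \<open>r = q\<close> and
  \<open>r = q^3\<close> the subfield of order \<open>r\<close> consists of the fixed points of \<open>x \<mapsto> x^r\<close>.
\<close>

definition GF :: "nat \<Rightarrow> 'a::field set" where
  "GF r = {x. x ^ r = x}"

definition squares :: "nat \<Rightarrow> 'a::field set" where
  "squares q = {c ^ 2 | c. c \<in> GF q - {0}}"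

definition field_trace :: "nat \<Rightarrow> nat \<Rightarrow> 'a::field \<Rightarrow> 'a" where
  "field_trace q n x = (\<Sum>i<n. x ^ (q ^ i))"

definition invariant_under :: "'a::field set \<Rightarrow> 'a set \<Rightarrow> bool" where
  "invariant_under S A \<longleftrightarrow> (\<forall>s\<in>S. \<forall>a\<in>A. s * a \<in> A)"

definition coset_reps :: "'a::field set \<Rightarrow> 'a set \<Rightarrow> 'a set \<Rightarrow> bool" where
  "coset_reps S A R \<longleftrightarrow> R \<subseteq> A \<and> (\<forall>a\<in>A. \<exists>!r. r \<in> R \<and> (\<exists>s\<in>S. a = s * r))"

section \<open>The polar space of a form over the small field\<close>

text \<open>
  The vector space is \<open>'a ^ 'n\<close> with scalars restricted to \<open>GF q\<close>. Points and generators are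
  represented by the corresponding \<open>GF q\<close>-subspaces, as sets of vectors.
\<close>

definition Fq_subspace :: "nat \<Rightarrow> ('a::field ^ 'n) set \<Rightarrow> bool" where
  "Fq_subspace q U \<longleftrightarrow>
     0 \<in> U \<and> (\<forall>x\<in>U. \<forall>y\<in>U. x + y \<in> U) \<and> (\<forall>c\<in>GF q. \<forall>x\<in>U. c *s x \<in> U)"

definition Fq_line :: "nat \<Rightarrow> 'a::field ^ 'n \<Rightarrow> ('a ^ 'n) set" where
  "Fq_line q v = {c *s v | c. c \<in> GF q}"

text \<open>Every one-dimensional subspace is a point, since the form is alternating in the application.\<close>

definition points :: "nat \<Rightarrow> ('a::field ^ 'n) set set" where
  "points q = {Fq_line q v | v. v \<noteq> 0}"

definition totally_isotropic ::
    "nat \<Rightarrow> ('a::field ^ 'n \<Rightarrow> 'a ^ 'n \<Rightarrow> 'a) \<Rightarrow> ('a ^ 'n) set \<Rightarrow> bool" where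
  "totally_isotropic q \<kappa> U \<longleftrightarrow> Fq_subspace q U \<and> (\<forall>x\<in>U. \<forall>y\<in>U. \<kappa> x y = 0)"

definition generator ::
    "nat \<Rightarrow> ('a::field ^ 'n \<Rightarrow> 'a ^ 'n \<Rightarrow> 'a) \<Rightarrow> ('a ^ 'n) set \<Rightarrow> bool" where
  "generator q \<kappa> U \<longleftrightarrow> totally_isotropic q \<kappa> U \<and>
     (\<forall>W. totally_isotropic q \<kappa> W \<and> U \<subseteq> W \<longrightarrow> W = U)"

definition m_ovoid ::
    "nat \<Rightarrow> ('a::field ^ 'n \<Rightarrow> 'a ^ 'n \<Rightarrow> 'a) \<Rightarrow> nat \<Rightarrow> ('a ^ 'n) set set \<Rightarrow> bool" where
  "m_ovoid q \<kappa> m M \<longleftrightarrow> M \<subseteq> points q \<and>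
     (\<forall>U. generator q \<kappa> U \<longrightarrow> card {P \<in> M. P \<subseteq> U} = m)"

section \<open>The Hermitian and symplectic forms\<close>

text \<open>
  \<open>symp\<close> takes its values in \<open>GF q\<close>. If \<open>\<mu> + \<mu>^(q^3) = 0\<close>, it is alternating, because
  \<open>herm q x x\<close> lies in \<open>GF (q^3)\<close>. The elements \<open>Fq_line q v\<close> of \<open>value_set q \<T>\<close> are points
  as soon as \<open>0 \<notin> \<T>\<close>.
\<close>

definition herm :: "nat \<Rightarrow> 'a::field ^ 'n \<Rightarrow> 'a ^ 'n \<Rightarrow> 'a" where
  "herm q x y = (\<Sum>i\<in>UNIV. x $ i * (y $ i) ^ (q ^ 3))"

definition symp :: "nat \<Rightarrow> 'a::field \<Rightarrow> 'a ^ 'n \<Rightarrow> 'a ^ 'n \<Rightarrow> 'a" where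
  "symp q \<mu> x y = field_trace q 6 (\<mu> * herm q x y)"

definition value_set :: "nat \<Rightarrow> 'a::field set \<Rightarrow> ('a ^ 'n) set set" where
  "value_set q \<T> = {Fq_line q v | v. herm q v v \<in> \<T>}"

end

theory Submission
  imports Defs "HOL-Computational_Algebra.Polynomial"
begin

text \<open>
  Adding a totally isotropic \<open>GF (q^6)\<close>-subspace to planes supported on one coordinate reduces the
  hypothesis to dimension one: there is a constant \<open>C\<close> such that every totally isotropic plane \<open>\<pi>\<close> of
  \<open>GF (q^6)\<close> contains exactly \<open>C\<close> vectors with norm in \<open>\<T>\<close>. The planes \<open>GF (q^3) v\<close> partition the
  nonzero vectors, hence \<open>C = |\<T>|\<close>.

  If \<open>z\<close> has norm in \<open>\<T>\<close>, then so has every nonzero vector of the line \<open>l = GF (q^2) z\<close>, because on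
  \<open>GF (q^2)\<close> the norm takes values in \<open>GF q\<close>. If \<open>l\<close> is totally isotropic, it lies in a totally
  isotropic plane and \<open>C \<ge> q^2 - 1\<close>. Otherwise a double count of planes shows that the number of
  vectors with norm in \<open>\<T>\<close> in the orthogonal space of \<open>l\<close> is \<open>(q + 1) C - q (q^2 - 1)\<close>, and this is
  nonnegative. In both cases \<open>|\<T>| \<ge> q (q - 1)\<close>, which is the claim after division by the number
  of nonzero squares.
\<close>

section \<open>Powers in finite fields\<close>

text \<open>Multiplication by \<open>x\<close> permutes the nonzero elements; comparing their
  product before and after, and cancelling it, gives the power.\<close>

lemma finite_field_power_card_minus_1:
  fixes x :: "'a::{field,finite}"
  assumes "x \<noteq> 0"
  shows "x ^ (CARD('a) - 1) = 1"
proof -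
  have "(\<Prod>y\<in>UNIV-{0::'a}. x * y) = (\<Prod>y\<in>UNIV-{0}. y)"
    by (rule prod.reindex_bij_witness[of _ "\<lambda>y. y / x" "\<lambda>y. x * y"]) (use assms in auto)
  then show ?thesis
    by (simp add: prod.distrib)
qed

lemma card_power_eq_le:
  fixes t :: "'a::{field,finite}"
  assumes "k > 0"
  shows "card {x. x ^ k = t} \<le> k"
proof -
  define p where "p = monom 1 k - [:t:]"
  have "coeff p k = 1"
    using assms by (simp add: p_def coeff_pCons split: nat.split)
  then have "p \<noteq> 0" by auto
  moreover have "degree p \<le> k"
    unfolding p_def by (intro degree_diff_le) (auto simp: degree_monom_le)
  moreover have "{x. x ^ k = t} = {x. poly p x = 0}"
    by (auto simp: p_def poly_monom)
  ultimately show ?thesis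
    using card_poly_roots_bound[of p] by simp
qed

text \<open>The map \<open>x \<mapsto> x ^ j\<close> sends the \<open>k * j\<close> nonzero elements
  to roots of \<open>x ^ k = 1\<close>. There are at most \<open>k\<close> such roots and each fibre
  has at most \<open>j\<close> elements, so both bounds are attained.\<close>

lemma
  fixes t :: "'a::{field,finite}"
  assumes kj: "k * j = CARD('a) - 1"
  shows card_roots_of_unity: "card {x::'a. x ^ k = 1} = k"
    and card_power_fibre: "t ^ k = 1 \<Longrightarrow> card {x. x ^ j = t} = j"
proof -
  have "card {0, 1::'a} \<le> CARD('a)" by (rule card_mono) auto
  then have pos: "k > 0" "j > 0" using kj by (auto intro!: Nat.gr0I)
  let ?R = "{x::'a. x ^ k = 1}" and ?F = "\<lambda>t::'a. {x. x ^ j = t}"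
  have "UNIV - {0::'a} = (\<Union>t\<in>?R. ?F t)"
    using finite_field_power_card_minus_1[where 'a='a, folded kj] pos
    by (auto simp: mult.commute[of k] power_mult power_0_left)
  then have "k * j = card (\<Union>t\<in>?R. ?F t)"
    using kj card_Diff_singleton[of "0::'a" UNIV] by simp
  also have "\<dots> = (\<Sum>t\<in>?R. card (?F t))"
    by (rule card_UN_disjoint) auto
  finally have sum: "k * j = (\<Sum>t\<in>?R. card (?F t))" .
  have le: "(\<Sum>t\<in>S. card (?F t)) \<le> card S * j" for S
    using sum_bounded_above[of S "\<lambda>t. card (?F t)" j] card_power_eq_le[OF pos(2)] by auto
  have "k \<le> card ?R"
    using le[of ?R] pos unfolding sum[symmetric] by simp
  then show R: "card ?R = k"
    using card_power_eq_le[OF pos(1), of "1::'a"] by linarith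
  show "card (?F t) = j" if "t ^ k = 1"
  proof -
    \<comment> \<open>The other \<open>k - 1\<close> fibres hold at most \<open>(k - 1) * j\<close>
      elements, which leaves at least \<open>j\<close> for the fibre over \<open>t\<close>.\<close>
    have "k * j = card (?F t) + (\<Sum>t\<in>?R - {t}. card (?F t))"
      unfolding sum using that by (intro sum.remove) auto
    also have "\<dots> \<le> card (?F t) + (k - 1) * j"
      using le[of "?R - {t}"] that R by (simp add: card_Diff_singleton)
    also have "k * j = (k - 1) * j + j"
      using pos by (cases k) auto
    finally show ?thesis
      using card_power_eq_le[OF pos(2), of t] by linarith
  qed
qed

lemma GF_eq_roots_of_unity:
  assumes "r > 0"
  shows "GF r = insert 0 {x::'a::field. x ^ (r - 1) = 1}"
proof -
  obtain s where "r = Suc s" using assms by (cases r) auto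
  then show ?thesis by (auto simp: GF_def)
qed

lemma card_GF:
  assumes "r > 1" and "(r - 1) dvd (CARD('a::{field,finite}) - 1)"
  shows "card (GF r :: 'a set) = r"
proof -
  obtain j where "(r - 1) * j = CARD('a) - 1"
    using assms(2) by (metis dvdE)
  then have "card {x::'a. x ^ (r - 1) = 1} = r - 1"
    by (rule card_roots_of_unity)
  moreover have "(0::'a) \<notin> {x. x ^ (r - 1) = 1}"
    using assms by (auto simp: power_0_left)
  ultimately show ?thesis
    using assms by (simp add: GF_eq_roots_of_unity)
qed

section \<open>Closure properties of the sets of fixed points\<close>

lemma zero_in_GF [simp]: "r > 0 \<Longrightarrow> 0 \<in> GF r"
  and one_in_GF [simp]: "1 \<in> GF r"
  and GF_mult [intro]: "x \<in> GF r \<Longrightarrow> y \<in> GF r \<Longrightarrow> x * y \<in> GF r"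
  and GF_power [intro]: "x \<in> GF r \<Longrightarrow> x ^ k \<in> GF r"
  and GF_inverse [intro]: "x \<in> GF r \<Longrightarrow> inverse x \<in> GF r"
  and GF_divide [intro]: "x \<in> GF r \<Longrightarrow> y \<in> GF r \<Longrightarrow> x / y \<in> GF r"
  by (auto simp: GF_def power_mult_distrib power_inverse power_divide simp flip: power_mult)
     (metis mult.commute power_mult)

lemma GF_power_power:
  assumes "x \<in> GF r"
  shows "x ^ (r ^ k) = x"
  using assms by (induction k) (auto simp: GF_def power_mult)

lemma GF_subset_GF_power: "GF r \<subseteq> GF (r ^ k)"
  using GF_power_power by (auto simp: GF_def)

text \<open>The number \<open>q\<close> turns out to be a power of the characteristic, so the
  library facts on Frobenius powers apply.\<close>

lemma
  fixes x y :: "'a::{field,finite}"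
  assumes "primepow q" and "CARD('a) = q ^ k" "k > 0"
  shows prime_power_add: "(x + y) ^ (q ^ i) = x ^ (q ^ i) + y ^ (q ^ i)"
    and prime_power_sum: "(\<Sum>j\<in>J. g j :: 'a) ^ (q ^ i) = (\<Sum>j\<in>J. g j ^ (q ^ i))"
proof -
  obtain p l where p: "prime p" "q = p ^ l"
    using assms(1) by (auto simp: primepow_def)
  have prime: "prime CHAR('a)"
    by (rule prime_CHAR_semidom) (auto intro: finite_imp_CHAR_pos)
  \<comment> \<open>Translation by 1 permutes the field, so summing all elements shows that
    \<open>CARD('a)\<close>, a power of \<open>p\<close>, vanishes in the field.\<close>
  have "(\<Sum>x\<in>UNIV. x + 1 :: 'a) = (\<Sum>x\<in>UNIV. x)"
    by (rule sum.reindex_bij_witness[of _ "\<lambda>x. x - 1" "\<lambda>x. x + 1"]) auto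
  then have "of_nat CARD('a) = (0::'a)"
    by (simp add: sum.distrib)
  then have "CHAR('a) dvd p"
    using prime unfolding of_nat_eq_0_iff_char_dvd assms(2) p(2)
    by (meson prime_dvd_power)
  then have "CHAR('a) = p"
    using prime p(1) by (simp add: primes_dvd_imp_eq)
  then have q: "q ^ i = CHAR('a) ^ (l * i)"
    using p(2) by (simp add: power_mult)
  show "(x + y) ^ (q ^ i) = x ^ (q ^ i) + y ^ (q ^ i)"
    by (rule freshmans_dream'[OF prime q])
  show "(\<Sum>j\<in>J. g j :: 'a) ^ (q ^ i) = (\<Sum>j\<in>J. g j ^ (q ^ i))"
    by (rule freshmans_dream_sum'[OF prime q])
qed

section \<open>The form\<close>

locale trace_form =
  fixes q :: nat and \<mu> :: "'a::{field,finite}"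
  assumes primepow: "primepow q"
    and card_field: "CARD('a) = q ^ 6"
    and \<mu>_nonzero: "\<mu> \<noteq> 0"
    and \<mu>_skew: "\<mu> + \<mu> ^ (q ^ 3) = 0"
begin

section \<open>Frobenius maps, orders of the subfields and the norm to
  \<open>GF (q ^ 3)\<close>\<close>

lemma q_gt_1: "q > 1"
  using primepow by (rule primepow_gt_Suc_0[unfolded One_nat_def[symmetric]])

lemma q_pos: "q > 0"
  using q_gt_1 by simp

lemma frob_add: "(x + y :: 'a) ^ (q ^ i) = x ^ (q ^ i) + y ^ (q ^ i)"
  by (rule prime_power_add[OF primepow card_field]) simp

lemma frob_sum: "(\<Sum>j\<in>J. g j :: 'a) ^ (q ^ i) = (\<Sum>j\<in>J. g j ^ (q ^ i))"
  by (rule prime_power_sum[OF primepow card_field]) simp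

lemma frob_minus: "(- x :: 'a) ^ (q ^ i) = - (x ^ (q ^ i))"
  using frob_add[of x "- x" i] q_pos by (simp add: eq_neg_iff_add_eq_0 power_0_left add.commute)

lemma frob_order: "(x::'a) ^ (q ^ 6) = x"
proof (cases "x = 0")
  case False
  then have "x ^ Suc (q ^ 6 - 1) = x"
    using finite_field_power_card_minus_1[OF False] by (simp add: card_field)
  then show ?thesis using q_pos by simp
qed (use q_pos in simp)

lemma card_GF_q:
  shows "card (GF q :: 'a set) = q"
    and "card (GF (q ^ 2) :: 'a set) = q ^ 2"
    and "card (GF (q ^ 3) :: 'a set) = q ^ 3"
proof -
  \<comment> \<open>Applied to \<open>q ^ 6\<close> read as a power of \<open>q\<close>, of
    \<open>q ^ 2\<close> and of \<open>q ^ 3\<close>, this provides the divisibility that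
    \<open>card_GF\<close> asks for.\<close>
  have "(r - 1) dvd (r ^ k - 1)" if r: "r > 0" for r k :: nat
  proof (induction k)
    case (Suc k)
    obtain s where "r = Suc s" using r by (cases r) auto
    moreover from this obtain m where "r ^ k = Suc m" by (cases "r ^ k") auto
    ultimately have "r ^ Suc k - 1 = r * (r ^ k - 1) + (r - 1)" by simp
    then show ?case using Suc by simp
  qed simp
  from this[of q 6] this[of "q^2" 3] this[of "q^3" 2]
  have dvd: "(q - 1) dvd CARD('a) - 1" "(q^2 - 1) dvd CARD('a) - 1" "(q^3 - 1) dvd CARD('a) - 1"
    using q_pos by (simp_all add: card_field flip: power_mult)
  show "card (GF q :: 'a set) = q" "card (GF (q ^ 2) :: 'a set) = q ^ 2"
    "card (GF (q ^ 3) :: 'a set) = q ^ 3"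
    using q_gt_1 dvd one_less_power[of q 2] one_less_power[of q 3] by (auto intro!: card_GF)
qed

lemma GF_add [intro]: "x \<in> GF q \<Longrightarrow> y \<in> GF q \<Longrightarrow> (x + y :: 'a) \<in> GF q"
  and GF_minus [intro]: "x \<in> GF q \<Longrightarrow> (- x :: 'a) \<in> GF q"
  using frob_add[of x y 1] frob_minus[of x 1] by (auto simp: GF_def)

lemma GF_diff [intro]: "x \<in> GF q \<Longrightarrow> y \<in> GF q \<Longrightarrow> (x - y :: 'a) \<in> GF q"
  using GF_add[of x "-y"] by auto

lemma norm_in_GF: "x * x ^ (q ^ 3) \<in> GF (q ^ 3)" for x :: 'a
  using frob_order[of x] by (simp add: GF_def power_mult_distrib flip: power_mult power_add)

text \<open>The norm is the power map with exponent \<open>q ^ 3 + 1\<close>, and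
  \<open>(q ^ 3 - 1) * (q ^ 3 + 1)\<close> is the order of the multiplicative group. In the proof
  \<open>r\<close> is \<open>q ^ 3 - 1\<close>, so the exponent is \<open>r + 2\<close>.\<close>

lemma card_norm_fibre:
  assumes "t \<in> GF (q ^ 3) - {0::'a}"
  shows "card {x. x * x ^ (q ^ 3) = t} = q ^ 3 + 1"
proof -
  obtain r where r: "q ^ 3 = Suc r" using q_pos by (metis gr0_implies_Suc zero_less_power)
  have "t ^ r = 1" using assms by (auto simp: GF_def r)
  moreover have "q ^ 6 = q ^ 3 * q ^ 3" by (simp flip: power_add)
  then have "r * (r + 2) = CARD('a) - 1" unfolding card_field r by simp
  ultimately show ?thesis
    using card_power_fibre[of r "r + 2" t] by (simp add: r)
qed

section \<open>The trace from the large field to \<open>GF q\<close>\<close>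

definition tr :: "'a \<Rightarrow> 'a" where
  "tr = field_trace q 6"

lemma tr_add: "tr (x + y) = tr x + tr y"
  by (simp add: tr_def field_trace_def frob_add sum.distrib)

lemma tr_scale: "c \<in> GF q \<Longrightarrow> tr (c * x) = c * tr x"
  by (simp add: tr_def field_trace_def power_mult_distrib GF_power_power sum_distrib_left)

text \<open>Raising to the power \<open>q\<close> shifts the six summands cyclically, since
  \<open>x ^ (q ^ 6) = x\<close>.\<close>

lemma tr_in_GF: "tr x \<in> GF q"
proof -
  have "tr x ^ q = (\<Sum>i<6. x ^ (q ^ Suc i))"
    using frob_sum[of "\<lambda>i. x ^ (q ^ i)" _ 1]
    by (simp add: tr_def field_trace_def mult.commute flip: power_mult)
  also have "\<dots> = tr x"
    using frob_order[of x]
    by (simp add: tr_def field_trace_def eval_nat_numeral)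
  finally show ?thesis by (simp add: GF_def)
qed

text \<open>The trace is a nonzero polynomial of degree at most \<open>q ^ 5\<close>, too small to
  vanish on all \<open>q ^ 6\<close> elements.\<close>

lemma tr_not_zero: "\<exists>x. tr x \<noteq> 0"
proof (rule ccontr)
  assume zero: "\<nexists>x. tr x \<noteq> 0"
  define p :: "'a poly" where "p = (\<Sum>i<6. monom 1 (q ^ i))"
  have "q ^ i = 1 \<longleftrightarrow> i = 0" for i using q_gt_1 by auto
  then have "coeff p 1 = 1"
    by (simp add: p_def coeff_sum)
  then have "p \<noteq> 0" by auto
  then have "card {x. poly p x = 0} \<le> degree p" by (rule card_poly_roots_bound)
  also have "degree p \<le> q ^ 5"
    unfolding p_def using q_gt_1
    by (intro degree_sum_le) (auto intro!: order_trans[OF degree_monom_le] power_increasing)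
  also have "\<dots> < CARD('a)"
    unfolding card_field using q_gt_1 by (intro power_strict_increasing) auto
  also have "{x. poly p x = 0} = UNIV"
    using zero by (auto simp: p_def poly_sum poly_monom tr_def field_trace_def)
  finally show False by simp
qed

section \<open>Linearity, alternation and nondegeneracy of the two forms\<close>

lemma herm_add_left: "herm q (x + y) z = herm q x z + herm q y (z :: 'a ^ 'n)"
  and herm_add_right: "herm q z (x + y) = herm q z x + herm q z (y :: 'a ^ 'n)"
  and herm_scale_left: "herm q (c *s x) z = c * herm q x z"
  and herm_scale_right: "herm q x (c *s z) = c ^ (q ^ 3) * herm q x z"
  by (simp_all add: herm_def frob_add ring_distribs sum.distrib sum_distrib_left
      power_mult_distrib mult_ac)

lemma herm_self_scale: "herm q (c *s x) (c *s x) = c * c ^ (q ^ 3) * herm q x (x :: 'a ^ 'n)"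
  by (simp add: herm_scale_left herm_scale_right)

lemma herm_self_in_GF: "herm q x x \<in> GF (q ^ 3)" for x :: "'a ^ 'n"
proof -
  have "herm q x x ^ (q ^ 3) = (\<Sum>i\<in>UNIV. (x $ i * (x $ i) ^ (q ^ 3)) ^ (q ^ 3))"
    unfolding herm_def by (rule frob_sum)
  then show ?thesis
    using norm_in_GF by (simp add: GF_def herm_def)
qed

lemma symp_eq: "symp q \<mu> x y = tr (\<mu> * herm q x y)"
  by (simp add: symp_def tr_def)

lemma symp_add_left: "symp q \<mu> (x + y) z = symp q \<mu> x z + symp q \<mu> y (z :: 'a ^ 'n)"
  and symp_add_right: "symp q \<mu> z (x + y) = symp q \<mu> z x + symp q \<mu> z (y :: 'a ^ 'n)"
  by (simp_all add: symp_eq herm_add_left herm_add_right ring_distribs tr_add)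

lemma symp_scale_left: "c \<in> GF q \<Longrightarrow> symp q \<mu> (c *s x) (z :: 'a ^ 'n) = c * symp q \<mu> x z"
  and symp_scale_right: "c \<in> GF q \<Longrightarrow> symp q \<mu> x (c *s z) = c * symp q \<mu> x z"
  using GF_power_power[of c q 3]
  by (simp_all add: symp_eq herm_scale_left herm_scale_right tr_scale mult.left_commute[of \<mu>])

lemma symp_zero [simp]: "symp q \<mu> 0 (z :: 'a ^ 'n) = 0" "symp q \<mu> z 0 = 0"
  using symp_add_left[of 0 0 z] symp_add_right[of z 0 0] unfolding add_0 add_cancel_right_right by blast+

lemma symp_in_GF: "symp q \<mu> x (y :: 'a ^ 'n) \<in> GF q"
  by (simp add: symp_eq tr_in_GF)

text \<open>The element \<open>\<mu> * s\<close> is negated by the power \<open>q ^ 3\<close>, so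
  the summands \<open>i\<close> and \<open>i + 3\<close> of its trace cancel.\<close>

lemma tr_mult_GF_eq_0:
  assumes "s \<in> GF (q ^ 3)"
  shows "tr (\<mu> * s) = 0"
proof -
  have "\<mu> ^ (q ^ 3) = - \<mu>"
    using \<mu>_skew by (simp add: eq_neg_iff_add_eq_0 add.commute)
  then have "(\<mu> * s) ^ (q ^ 3) = - (\<mu> * s)"
    using assms by (simp add: power_mult_distrib GF_def)
  then have "(\<mu> * s) ^ (q ^ (3 + i)) = - ((\<mu> * s) ^ (q ^ i))" for i
    by (simp add: power_add power_mult frob_minus)
  from this[of 0] this[of 1] this[of 2]
  show ?thesis
    by (simp add: tr_def field_trace_def eval_nat_numeral)
qed

lemma symp_self [simp]: "symp q \<mu> x (x :: 'a ^ 'n) = 0"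
  by (simp add: symp_eq tr_mult_GF_eq_0 herm_self_in_GF)

lemma symp_skew: "symp q \<mu> y x = - symp q \<mu> x (y :: 'a ^ 'n)"
  using symp_self[of "x + y"]
  by (simp add: symp_add_left symp_add_right eq_neg_iff_add_eq_0 add.commute del: symp_self)
     (simp add: add.commute)

lemma symp_nondegenerate:
  fixes x :: "'a ^ 'n"
  assumes "x \<noteq> 0"
  shows "\<exists>y. symp q \<mu> y x \<noteq> 0"
proof -
  obtain i where i: "x $ i \<noteq> 0" using assms by (auto simp: vec_eq_iff)
  obtain a where a: "tr a \<noteq> 0" using tr_not_zero by blast
  have herm: "herm q (axis i b) x = b * x $ i ^ (q ^ 3)" for b
    unfolding herm_def by (subst sum.remove[of _ i]) (auto simp: axis_def intro!: sum.neutral)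
  \<comment> \<open>The entry is chosen so that \<open>\<mu> * herm q _ x\<close> becomes
    \<open>a\<close>, an element of nonzero trace.\<close>
  have "symp q \<mu> (axis i (a / (\<mu> * x $ i ^ (q ^ 3)))) x \<noteq> 0"
    using a i \<mu>_nonzero by (simp add: symp_eq herm)
  then show ?thesis ..
qed

section \<open>Orthogonal spaces and the size of totally isotropic subspaces\<close>

definition perp :: "('a ^ 'n) set \<Rightarrow> ('a ^ 'n) set" where
  "perp U = {y. \<forall>x\<in>U. symp q \<mu> x y = 0}"

lemma Fq_subspace_perp: "Fq_subspace q (perp U)"
  by (auto simp: Fq_subspace_def perp_def symp_add_right symp_scale_right)

lemma Fq_subspace_diff:
  assumes "Fq_subspace q U" "x \<in> U" "y \<in> U"
  shows "x - y \<in> (U :: ('a ^ 'n) set)"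
proof -
  have "(- 1) *s y \<in> U"
    using assms GF_minus[OF one_in_GF] by (auto simp: Fq_subspace_def)
  then have "x + (- 1) *s y \<in> U"
    using assms by (auto simp: Fq_subspace_def)
  then show ?thesis by simp
qed

text \<open>Pairing with \<open>y\<close> is a nonzero \<open>GF q\<close>-linear functional on
  \<open>U\<close>. It takes all \<open>q\<close> values, and its fibres are translates of the
  kernel by multiples of a vector \<open>e\<close> of value 1.\<close>

lemma card_kernel:
  fixes U :: "('a ^ 'n) set"
  assumes U: "Fq_subspace q U" and "\<exists>x\<in>U. symp q \<mu> x y \<noteq> 0"
  shows "card U = q * card {x \<in> U. symp q \<mu> x y = 0}"
proof -
  let ?F = "\<lambda>t. {x \<in> U. symp q \<mu> x y = t}"
  obtain x where x: "x \<in> U" "symp q \<mu> x y \<noteq> 0" using assms(2) by blast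
  define e where "e = inverse (symp q \<mu> x y) *s x"
  have e: "e \<in> U" "symp q \<mu> e y = 1"
    using x U GF_inverse[OF symp_in_GF[of x y]]
    by (simp_all add: e_def Fq_subspace_def symp_scale_left)
  have fibre: "card (?F t) = card (?F 0)" if t: "t \<in> GF q" for t
  proof (rule bij_betw_same_card)
    have te: "t *s e \<in> U" using e t U by (auto simp: Fq_subspace_def)
    have sub: "symp q \<mu> (v - t *s e) y = symp q \<mu> v y - t" if "t \<in> GF q" for t v
      using symp_add_left[of "v - t *s e" "t *s e" y] e that by (simp add: symp_scale_left)
    show "bij_betw (\<lambda>v. v - t *s e) (?F t) (?F 0)"
      by (rule bij_betw_byWitness[where f' = "\<lambda>v. v + t *s e"])
        (use te e t U Fq_subspace_diff[OF U] in
          \<open>auto simp: sub symp_add_left symp_scale_left Fq_subspace_def\<close>)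
  qed
  have "U = (\<Union>t\<in>GF q. ?F t)" using symp_in_GF by auto
  then have "card U = card (\<Union>t\<in>GF q. ?F t)" by simp
  also have "\<dots> = (\<Sum>t\<in>GF q. card (?F t))"
    by (rule card_UN_disjoint) auto
  also have "\<dots> = q * card (?F 0)"
    using fibre by (simp add: card_GF_q)
  finally show ?thesis .
qed

text \<open>Double counting of the orthogonal pairs in \<open>U \<times> V\<close>.\<close>

lemma card_perp:
  fixes U :: "('a ^ 'n) set"
  assumes U: "Fq_subspace q U"
  shows "card U * card (perp U) = CARD('a ^ 'n)"
proof -
  let ?V = "CARD('a ^ 'n)" and ?P = "card (perp U)"
  have zero: "0 \<in> U" using U by (simp add: Fq_subspace_def)
  \<comment> \<open>Both kernel counts are multiplied by \<open>q\<close> to avoid division. The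
    exceptions are the zero vector on this side and the vectors of \<open>perp U\<close> on the
    other.\<close>
  have left: "q * card {y. symp q \<mu> x y = 0} = (if x = 0 then q * ?V else ?V)" for x :: "'a ^ 'n"
  proof (cases "x = 0")
    case False
    have "{y. symp q \<mu> x y = 0} = {y \<in> UNIV. symp q \<mu> y x = 0}"
      by (simp add: symp_skew[of x])
    moreover have "?V = q * card {y \<in> UNIV. symp q \<mu> y x = 0}"
      by (rule card_kernel) (use symp_nondegenerate[OF False] in \<open>auto simp: Fq_subspace_def\<close>)
    ultimately show ?thesis using False by simp
  qed simp
  have right: "q * card {x\<in>U. symp q \<mu> x y = 0} = (if y \<in> perp U then q * card U else card U)" for y
  proof (cases "y \<in> perp U")
    case True
    then have "{x\<in>U. symp q \<mu> x y = 0} = U" by (auto simp: perp_def)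
    then show ?thesis using True by simp
  qed (use card_kernel[OF U] in \<open>auto simp: perp_def\<close>)
  have U1: "card U = (card U - 1) + 1"
    using zero card_gt_0_iff[of U] by auto
  have "q * ?V + (card U - 1) * ?V = (\<Sum>x\<in>U. if x = 0 then q * ?V else ?V)"
    using zero by (subst sum.remove[of _ 0]) (auto simp: card_Diff_singleton)
  also have "\<dots> = q * (\<Sum>x\<in>U. \<Sum>y | y \<in> UNIV \<and> symp q \<mu> x y = 0. 1)"
    using left by (simp add: sum_distrib_left)
  also have "(\<Sum>x\<in>U. \<Sum>y | y \<in> UNIV \<and> symp q \<mu> x y = 0. 1::nat)
      = (\<Sum>y\<in>UNIV. \<Sum>x | x \<in> U \<and> symp q \<mu> x y = 0. 1)"
    by (rule sum.swap_restrict) auto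
  also have "q * \<dots> = (\<Sum>y\<in>UNIV. if y \<in> perp U then q * card U else card U)"
    using right by (simp add: sum_distrib_left)
  also have "\<dots> = ?P * (q * card U) + (?V - ?P) * card U"
    by (simp add: sum.If_cases card_Diff_subset flip: Compl_eq_Diff_UNIV)
       (simp add: Compl_eq_Diff_UNIV card_Diff_subset)
  finally have eq: "q * ?V + (card U - 1) * ?V = ?P * (q * card U) + (?V - ?P) * card U" .
  have le: "?P \<le> ?V" by (rule card_mono) auto
  obtain u r where u: "card U = Suc u" and r: "q = Suc r" "r > 0"
    using U1 q_gt_1 by (metis Suc_eq_plus1 One_nat_def Suc_lessE zero_less_iff_neq_zero)
  from le obtain k where k: "?V = ?P + k" using le_Suc_ex by blast
  \<comment> \<open>With \<open>q = r + 1\<close>, both sides of \<open>eq\<close> contain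
    \<open>card U * ?V\<close>; removing it leaves this equation.\<close>
  have "r * ?V = r * (card U * ?P)"
    using eq k unfolding u r(1) by (simp only: diff_add_inverse diff_Suc_1) (simp add: algebra_simps)
  then show ?thesis using \<open>r > 0\<close> by simp
qed

text \<open>Since \<open>U\<close> lies in \<open>perp U\<close>, the square of its size is at most
  the size of the whole space. A totally isotropic subspace that attains the bound is therefore
  maximal.\<close>

lemma card_totally_isotropic_le:
  fixes U :: "('a ^ 'n) set"
  assumes "totally_isotropic q (symp q \<mu>) U"
  shows "card U \<le> q ^ (3 * CARD('n))"
proof -
  have "card U \<le> card (perp U)"
    by (rule card_mono) (use assms in \<open>auto simp: totally_isotropic_def perp_def\<close>)
  then have "card U * card U \<le> card U * card (perp U)" by simp
  also have "\<dots> = CARD('a ^ 'n)"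
    using assms by (intro card_perp) (simp add: totally_isotropic_def)
  also have "\<dots> = (q ^ (3 * CARD('n)))\<^sup>2"
    by (simp add: card_field flip: power_mult)
  finally show ?thesis
    unfolding power2_eq_square[symmetric] power2_nat_le_eq_le .
qed

lemma generatorI:
  fixes U :: "('a ^ 'n) set"
  assumes "totally_isotropic q (symp q \<mu>) U" "card U = q ^ (3 * CARD('n))"
  shows "generator q (symp q \<mu>) U"
proof -
  have "W = U" if "totally_isotropic q (symp q \<mu>) W" "U \<subseteq> W" for W
    using card_totally_isotropic_le[OF that(1)] that(2) assms(2)
    by (intro card_seteq[symmetric]) auto
  then show ?thesis using assms(1) by (auto simp: generator_def)
qed

section \<open>Counting vectors instead of points\<close>

text \<open>A point of the value set has \<open>q - 1\<close> nonzero vectors, and the invariance of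
  \<open>\<T>\<close> puts the norms of all of them into \<open>\<T>\<close>.\<close>

lemma card_value_points:
  fixes U :: "('a ^ 'n) set"
  assumes U: "Fq_subspace q U" and zero: "0 \<notin> \<T>"
    and inv: "invariant_under (GF q - {0}) \<T>"
  shows "(q - 1) * card {P \<in> value_set q \<T>. P \<subseteq> U} = card {v \<in> U. herm q v v \<in> \<T>}"
proof -
  let ?A = "{v \<in> U. herm q v v \<in> \<T>}"
  have points: "{P \<in> value_set q \<T>. P \<subseteq> U} = Fq_line q ` ?A"
  proof -
    have "Fq_line q v \<subseteq> U \<longleftrightarrow> v \<in> U" for v
    proof
      have "1 *s v \<in> Fq_line q v" unfolding Fq_line_def using one_in_GF by blast
      then show "Fq_line q v \<subseteq> U \<Longrightarrow> v \<in> U" by auto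
    qed (use U in \<open>auto simp: Fq_line_def Fq_subspace_def\<close>)
    then show ?thesis by (auto simp: value_set_def)
  qed
  have fibre: "card {v \<in> ?A. Fq_line q v = Fq_line q w} = q - 1" if w: "w \<in> ?A" for w
  proof -
    have "w \<noteq> 0" using w zero by (auto simp: herm_def power_0_left)
    then have inj: "inj_on (\<lambda>c. c *s w) (GF q - {0})"
      by (auto simp: inj_on_def vector_mul_rcancel)
    have "{v \<in> ?A. Fq_line q v = Fq_line q w} = (\<lambda>c. c *s w) ` (GF q - {0})"
    proof (intro equalityI subsetI)
      fix v assume v: "v \<in> {v \<in> ?A. Fq_line q v = Fq_line q w}"
      have "1 *s v \<in> Fq_line q v" unfolding Fq_line_def using one_in_GF by blast
      then have "v \<in> Fq_line q w" using v by simp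
      then obtain c where c: "c \<in> GF q" "v = c *s w" by (auto simp: Fq_line_def)
      moreover have "v \<noteq> 0" using v zero by (auto simp: herm_def power_0_left)
      ultimately show "v \<in> (\<lambda>c. c *s w) ` (GF q - {0})" by auto
    next
      fix v assume "v \<in> (\<lambda>c. c *s w) ` (GF q - {0})"
      then obtain c where c: "c \<in> GF q" "c \<noteq> 0" "v = c *s w" by auto
      \<comment> \<open>For \<open>c\<close> in \<open>GF q\<close> the norm of \<open>c\<close> is
        \<open>c * c\<close>, so invariance is applied twice.\<close>
      have "c * (c * herm q w w) \<in> \<T>"
        using inv w c by (auto simp: invariant_under_def)
      then have "v \<in> ?A"
        using U w c GF_power_power[of c q 3]
        by (auto simp: herm_self_scale Fq_subspace_def mult.assoc)
      moreover have "Fq_line q v = Fq_line q w"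
      proof -
        have "a *s v = (a * c) *s w" "a *s w = (a / c) *s v" for a
          using c by auto
        then have "a *s v \<in> Fq_line q w" "a *s w \<in> Fq_line q v" if "a \<in> GF q" for a
          using that c(1) unfolding Fq_line_def by blast+
        then show ?thesis unfolding Fq_line_def by blast
      qed
      ultimately show "v \<in> {v \<in> ?A. Fq_line q v = Fq_line q w}" by simp
    qed
    then show ?thesis
      using inj card_GF_q(1) q_pos by (simp add: card_image card_Diff_singleton)
  qed
  have "card ?A = (\<Sum>P\<in>Fq_line q ` ?A. card {v \<in> ?A. Fq_line q v = P})"
    using sum.image_gen[of ?A "\<lambda>_. 1::nat" "Fq_line q"] by simp
  also have "\<dots> = card (Fq_line q ` ?A) * (q - 1)"
    using fibre by (subst sum.cong[OF refl, of _ _ "\<lambda>_. q - 1"]) auto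
  finally show ?thesis
    by (simp add: points mult.commute)
qed

section \<open>Reduction to dimension one\<close>

text \<open>
  All coordinates but one are paired, and each pair of coordinates supports a totally isotropic
  line: \<open>(x, \<alpha> x)\<close> is isotropic as \<open>\<alpha>\<close> has norm \<open>-1\<close>. Adding these lines to a subspace supported
  on the remaining coordinate does not change the values of the Hermitian form.
\<close>

lemma hermitian_lift:
  assumes odd: "odd CARD('n::finite)"
  obtains W :: "('a ^ 'n) set" and \<rho> :: "'a ^ 'n \<Rightarrow> 'a ^ 1"
  where "Fq_subspace q W"
    and "\<And>x y. \<rho> (x + y) = \<rho> x + \<rho> y" and "\<And>c x. \<rho> (c *s x) = c *s \<rho> x"
    and "\<And>x y. x \<in> W \<Longrightarrow> y \<in> W \<Longrightarrow> herm q x y = herm q (\<rho> x) (\<rho> y)"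
    and "\<And>S. card {x \<in> W. \<rho> x \<in> S} = card S * q ^ (3 * CARD('n) - 3)"
proof -
  \<comment> \<open>An arbitrary coordinate is singled out; the remaining \<open>2 * k\<close> are
    split into \<open>A\<close> and \<open>B\<close>, matched by \<open>\<tau>\<close>.\<close>
  obtain p :: 'n where True by simp
  obtain k where k: "CARD('n) = 2 * k + 1" using odd by (rule oddE)
  have "k \<le> card (UNIV - {p})" using k by (simp add: card_Diff_singleton)
  then obtain A where A: "A \<subseteq> UNIV - {p}" "card A = k"
    by (rule obtain_subset_with_card_n)
  define B where "B = UNIV - {p} - A"
  have "card B = k"
    using A k by (simp add: B_def card_Diff_subset card_Diff_singleton)
  then obtain \<tau> where \<tau>: "bij_betw \<tau> A B"
    using A finite_same_card_bij[of A B] by auto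
  have "- 1 \<in> GF (q ^ 3) - {0::'a}"
    using frob_minus[of 1 3] by (simp add: GF_def)
  from card_norm_fibre[OF this] obtain \<alpha> :: 'a where \<alpha>: "\<alpha> * \<alpha> ^ (q ^ 3) = - 1"
    by (metis (mono_tags, lifting) Collect_empty_eq Suc_eq_plus1 card.empty nat.distinct(1))
  define W :: "('a ^ 'n) set" where "W = {v. \<forall>i\<in>A. v $ \<tau> i = \<alpha> * v $ i}"
  define \<rho> :: "'a ^ 'n \<Rightarrow> 'a ^ 1" where "\<rho> v = vec (v $ p)" for v
  have split: "sum h UNIV = h p + (\<Sum>i\<in>A. h i + h (\<tau> i))" for h :: "'n \<Rightarrow> 'a"
  proof -
    have "sum h UNIV = h p + sum h (UNIV - {p})" by (rule sum.remove) auto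
    also have "UNIV - {p} = A \<union> B" using A by (auto simp: B_def)
    also have "sum h (A \<union> B) = sum h A + sum h B"
      by (rule sum.union_disjoint) (auto simp: B_def)
    also have "sum h B = (\<Sum>i\<in>A. h (\<tau> i))"
      using sum.reindex_bij_betw[OF \<tau>, of h] by simp
    finally show ?thesis by (simp add: sum.distrib)
  qed
  show ?thesis
  proof
    show "Fq_subspace q W"
      by (auto simp: Fq_subspace_def W_def ring_distribs)
    show "\<rho> (x + y) = \<rho> x + \<rho> y" "\<rho> (c *s x) = c *s \<rho> x" for x y c
      by (simp_all add: \<rho>_def vec_eq_iff)
    show "herm q x y = herm q (\<rho> x) (\<rho> y)" if "x \<in> W" "y \<in> W" for x y
    proof -
      have "x $ i * y $ i ^ (q ^ 3) + x $ \<tau> i * y $ \<tau> i ^ (q ^ 3) = 0" if "i \<in> A" for i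
      proof -
        have "x $ \<tau> i * y $ \<tau> i ^ (q ^ 3) = (\<alpha> * \<alpha> ^ (q ^ 3)) * (x $ i * y $ i ^ (q ^ 3))"
          using \<open>x \<in> W\<close> \<open>y \<in> W\<close> that by (simp add: W_def power_mult_distrib)
        then show ?thesis by (simp add: \<alpha>)
      qed
      then show ?thesis
        unfolding herm_def by (subst split) (simp add: \<rho>_def)
    qed
    show "card {x \<in> W. \<rho> x \<in> S} = card S * q ^ (3 * CARD('n) - 3)" for S
    proof -
      \<comment> \<open>A vector of \<open>W\<close> is determined by its entry at \<open>p\<close>
        and its entries on \<open>A\<close>, and these are free. Hence \<open>q ^ (6 * k)\<close>
        vectors lie over each value of \<open>\<rho>\<close>, and
        \<open>6 * k = 3 * CARD('n) - 3\<close>.\<close>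
      define \<phi> where "\<phi> v = (\<rho> v, restrict (\<lambda>i. v $ i) A)" for v
      define \<psi> where "\<psi> = (\<lambda>(s :: 'a ^ 1, g). (\<chi> i. if i = p then s $ 1 else
        if i \<in> A then g i else \<alpha> * g (inv_into A \<tau> i)) :: 'a ^ 'n)"
      have \<tau>B: "\<tau> i \<in> B" "inv_into A \<tau> (\<tau> i) = i" if "i \<in> A" for i
        using \<tau> that by (auto simp: bij_betw_def)
      have invB: "inv_into A \<tau> i \<in> A" "\<tau> (inv_into A \<tau> i) = i" if "i \<in> B" for i
        using \<tau> that by (auto simp: bij_betw_def inv_into_into f_inv_into_f)
      have neq: "\<tau> i \<noteq> p" "\<tau> i \<notin> A" "i \<noteq> p" if "i \<in> A" for i
        using \<tau>B[OF that] that A by (auto simp: B_def)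
      have "bij_betw \<phi> {x \<in> W. \<rho> x \<in> S} (S \<times> (A \<rightarrow>\<^sub>E UNIV))"
      proof (rule bij_betw_byWitness[where f' = \<psi>])
        show "\<forall>v\<in>{x \<in> W. \<rho> x \<in> S}. \<psi> (\<phi> v) = v"
        proof
          fix v assume "v \<in> {x \<in> W. \<rho> x \<in> S}"
          then have v: "v $ \<tau> i = \<alpha> * v $ i" if "i \<in> A" for i using that by (auto simp: W_def)
          have "v $ i = \<alpha> * v $ inv_into A \<tau> i" if "i \<in> B" for i
            using v[OF invB(1)[OF that]] invB(2)[OF that] by simp
          then show "\<psi> (\<phi> v) = v"
            using invB(1) by (auto simp: \<psi>_def \<phi>_def \<rho>_def vec_eq_iff B_def)
        qed
        show "\<forall>x\<in>S \<times> (A \<rightarrow>\<^sub>E UNIV). \<phi> (\<psi> x) = x"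
          using neq by (auto simp: \<psi>_def \<phi>_def \<rho>_def vec_eq_iff fun_eq_iff PiE_def extensional_def)
        show "\<phi> ` {x \<in> W. \<rho> x \<in> S} \<subseteq> S \<times> (A \<rightarrow>\<^sub>E UNIV)"
          by (auto simp: \<phi>_def)
        show "\<psi> ` (S \<times> (A \<rightarrow>\<^sub>E UNIV)) \<subseteq> {x \<in> W. \<rho> x \<in> S}"
        proof
          fix v assume "v \<in> \<psi> ` (S \<times> (A \<rightarrow>\<^sub>E UNIV))"
          then obtain s g where sg: "s \<in> S" "v = \<psi> (s, g)" by auto
          have "\<rho> v = s" by (simp add: sg \<psi>_def \<rho>_def vec_eq_iff)
          then show "v \<in> {x \<in> W. \<rho> x \<in> S}"
            using sg neq \<tau>B by (auto simp: \<psi>_def W_def)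
        qed
      qed
      then have "card {x \<in> W. \<rho> x \<in> S} = card (S \<times> (A \<rightarrow>\<^sub>E (UNIV :: 'a set)))"
        by (rule bij_betw_same_card)
      also have "\<dots> = card S * q ^ (6 * k)"
        using A by (simp add: card_cartesian_product card_funcsetE card_field flip: power_mult)
      finally show ?thesis by (simp add: k)
    qed
  qed
qed

text \<open>The preimage of \<open>\<pi>\<close> in \<open>W\<close> is totally isotropic of the
  maximal size, hence a generator with \<open>m\<close> points of the ovoid. As
  \<open>\<rho>\<close> preserves the norm and has fibres of constant size on \<open>W\<close>, the
  count of vectors descends to \<open>\<pi>\<close>.\<close>

lemma m_ovoid_plane_card:
  fixes \<pi> :: "('a ^ 1) set"
  assumes odd: "odd CARD('n::finite)" and zero: "0 \<notin> \<T>"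
    and inv: "invariant_under (GF q - {0}) \<T>"
    and ovoid: "m_ovoid q (symp q \<mu>) m (value_set q \<T> :: ('a ^ 'n) set set)"
    and \<pi>: "totally_isotropic q (symp q \<mu>) \<pi>" "card \<pi> = q ^ 3"
  shows "card {v \<in> \<pi>. herm q v v \<in> \<T>} * q ^ (3 * CARD('n) - 3) = (q - 1) * m"
proof -
  obtain W :: "('a ^ 'n) set" and \<rho> :: "'a ^ 'n \<Rightarrow> 'a ^ 1"
    where W: "Fq_subspace q W"
      and \<rho>: "\<And>x y. \<rho> (x + y) = \<rho> x + \<rho> y" "\<And>c x. \<rho> (c *s x) = c *s \<rho> x"
      and herm: "\<And>x y. x \<in> W \<Longrightarrow> y \<in> W \<Longrightarrow> herm q x y = herm q (\<rho> x) (\<rho> y)"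
      and card: "\<And>S. card {x \<in> W. \<rho> x \<in> S} = card S * q ^ (3 * CARD('n) - 3)"
    using hermitian_lift[OF odd] by blast
  define U where "U = {x \<in> W. \<rho> x \<in> \<pi>}"
  have "\<rho> 0 = 0" using \<rho>(2)[of 0 0] by simp
  then have sub: "Fq_subspace q U"
    using W \<pi>(1) by (auto simp: U_def Fq_subspace_def totally_isotropic_def \<rho>)
  have "totally_isotropic q (symp q \<mu>) U"
    using sub \<pi>(1) by (auto simp: totally_isotropic_def U_def symp_def herm)
  moreover have "CARD('n) \<ge> 1" by (simp add: Suc_le_eq)
  then have "card U = q ^ (3 * CARD('n))"
    unfolding U_def card \<pi>(2) by (simp flip: power_add)
  ultimately have "generator q (symp q \<mu>) U" by (rule generatorI)
  then have "card {P \<in> value_set q \<T>. P \<subseteq> U} = m"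
    using ovoid by (auto simp: m_ovoid_def)
  then have "(q - 1) * m = card {v \<in> U. herm q v v \<in> \<T>}"
    using card_value_points[OF sub zero inv] by simp
  also have "{v \<in> U. herm q v v \<in> \<T>} = {x \<in> W. \<rho> x \<in> {v \<in> \<pi>. herm q v v \<in> \<T>}}"
    using herm by (auto simp: U_def)
  finally show ?thesis
    unfolding card by simp
qed

section \<open>Lines and direct sums\<close>

lemma Fq_line_eq_image: "Fq_line r v = (\<lambda>c. c *s v) ` GF r"
  by (auto simp: Fq_line_def)

lemma inj_on_scale: "v \<noteq> 0 \<Longrightarrow> inj_on (\<lambda>c. c *s (v :: 'a ^ 'n)) S"
  by (auto simp: inj_on_def vector_mul_rcancel)

lemma card_Fq_line: "v \<noteq> (0 :: 'a ^ 'n) \<Longrightarrow> card (Fq_line r v) = card (GF r :: 'a set)"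
  by (simp add: Fq_line_eq_image card_image inj_on_scale)

lemma sum_Fq_line: "v \<noteq> (0 :: 'a ^ 'n) \<Longrightarrow> sum g (Fq_line r v) = (\<Sum>c\<in>GF r. g (c *s v))"
  by (simp add: Fq_line_eq_image sum.reindex inj_on_scale)

lemma Fq_subspace_Fq_line: "Fq_subspace q (Fq_line (q ^ k) (v :: 'a ^ 'n))"
  unfolding Fq_subspace_def Fq_line_eq_image
proof (intro conjI ballI; (elim imageE)?)
  show "0 \<in> (\<lambda>c. c *s v) ` GF (q ^ k)"
    using q_pos by (intro image_eqI[of _ _ 0]) auto
  show "x + y \<in> (\<lambda>c. c *s v) ` GF (q ^ k)"
    if "x = a *s v" "a \<in> GF (q ^ k)" "y = b *s v" "b \<in> GF (q ^ k)" for x y a b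
    using that by (intro image_eqI[of _ _ "a + b"]) (auto simp: GF_def frob_add vec_eq_iff ring_distribs)
  show "c *s x \<in> (\<lambda>c. c *s v) ` GF (q ^ k)"
    if "c \<in> GF q" "x = a *s v" "a \<in> GF (q ^ k)" for x c a
    using that GF_subset_GF_power[of q k] by (intro image_eqI[of _ _ "c * a"]) auto
qed

lemma totally_isotropic_Fq_line: "totally_isotropic q (symp q \<mu>) (Fq_line q (v :: 'a ^ 'n))"
  using Fq_subspace_Fq_line[of 1 v]
  by (auto simp: totally_isotropic_def Fq_line_def symp_scale_left symp_scale_right)

definition subspace_sum :: "('a ^ 'n) set \<Rightarrow> ('a ^ 'n) set \<Rightarrow> ('a ^ 'n) set" where
  "subspace_sum U W = (\<lambda>(x, y). x + y) ` (U \<times> W)"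

text \<open>Trivial intersection makes addition injective on \<open>U \<times> W\<close>, so the sum
  may be indexed by pairs.\<close>

lemma
  fixes U W :: "('a ^ 'n) set"
  assumes U: "Fq_subspace q U" and W: "Fq_subspace q W" and UW: "U \<inter> W = {0}"
  shows sum_subspace_sum: "sum g (subspace_sum U W) = (\<Sum>x\<in>U. \<Sum>y\<in>W. g (x + y))"
    and card_subspace_sum: "card (subspace_sum U W) = card U * card W"
proof -
  have "inj_on (\<lambda>(x, y). x + y) (U \<times> W)"
  proof (rule inj_onI; clarify)
    fix x y x' y' assume *: "x \<in> U" "y \<in> W" "x' \<in> U" "y' \<in> W" "x + y = x' + y'"
    then have "x - x' = y' - y" by (simp add: algebra_simps)
    moreover have "x - x' \<in> U" "y' - y \<in> W"
      using * Fq_subspace_diff U W by auto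
    ultimately have "x - x' \<in> U \<inter> W" by simp
    then show "x = x' \<and> y = y'" using *(5) unfolding UW by auto
  qed
  then show "sum g (subspace_sum U W) = (\<Sum>x\<in>U. \<Sum>y\<in>W. g (x + y))"
    and "card (subspace_sum U W) = card U * card W"
    unfolding subspace_sum_def
    by (simp_all add: sum.reindex card_image card_cartesian_product sum.cartesian_product
        case_prod_unfold comp_def)
qed

lemma totally_isotropic_subspace_sum:
  fixes U W :: "('a ^ 'n) set"
  assumes U: "totally_isotropic q (symp q \<mu>) U" and W: "totally_isotropic q (symp q \<mu>) W"
    and UW: "W \<subseteq> perp U"
  shows "totally_isotropic q (symp q \<mu>) (subspace_sum U W)"
  unfolding totally_isotropic_def Fq_subspace_def subspace_sum_def
proof (intro conjI ballI; (elim imageE SigmaE)?)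
  note sub = U[unfolded totally_isotropic_def Fq_subspace_def]
    W[unfolded totally_isotropic_def Fq_subspace_def]
  show "0 \<in> (\<lambda>(x, y). x + y) ` (U \<times> W)"
    using sub by (intro image_eqI[of _ _ "(0, 0)"]) auto
  have orth: "symp q \<mu> x y = 0" "symp q \<mu> y x = 0" if "x \<in> U" "y \<in> W" for x y
    using that UW symp_skew[of x y] by (auto simp: perp_def)
  fix p x y assume "x \<in> U" "y \<in> W" "p = (x, y)"
  fix v assume v: "v = (\<lambda>(x, y). x + y) p"
  show "c *s v \<in> (\<lambda>(x, y). x + y) ` (U \<times> W)" if "c \<in> GF q" for c
    using \<open>p = (x, y)\<close> \<open>x \<in> U\<close> \<open>y \<in> W\<close> sub that
    by (intro image_eqI[of _ _ "(c *s x, c *s y)"]) (auto simp: v vector_add_ldistrib)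
  fix p' x' y' assume "x' \<in> U" "y' \<in> W" "p' = (x', y')"
  fix v' assume v': "v' = (\<lambda>(x, y). x + y) p'"
  show "v + v' \<in> (\<lambda>(x, y). x + y) ` (U \<times> W)"
    using \<open>p = (x, y)\<close> \<open>x \<in> U\<close> \<open>y \<in> W\<close> \<open>p' = (x', y')\<close> \<open>x' \<in> U\<close> \<open>y' \<in> W\<close> sub
    by (intro image_eqI[of _ _ "(x + x', y + y')"]) (auto simp: v v')
  show "symp q \<mu> v v' = 0"
    using \<open>p = (x, y)\<close> \<open>x \<in> U\<close> \<open>y \<in> W\<close> \<open>p' = (x', y')\<close> \<open>x' \<in> U\<close> \<open>y' \<in> W\<close> sub orth
    by (simp add: v v' symp_add_left symp_add_right)
qed

section \<open>Orthogonal pairs\<close>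

text \<open>For a subspace \<open>X\<close> these are the ordered bases of its totally isotropic
  two-dimensional subspaces. Bases are counted rather than subspaces, so that sums can be
  transformed by changes of basis.\<close>

definition orthogonal_pairs :: "('a ^ 'n) set \<Rightarrow> (('a ^ 'n) \<times> ('a ^ 'n)) set" where
  "orthogonal_pairs X = {(u, w). u \<in> X \<and> w \<in> X \<and> symp q \<mu> u w = 0 \<and>
     (\<forall>b\<in>GF q. \<forall>c\<in>GF q. b *s u + c *s w = 0 \<longrightarrow> b = 0 \<and> c = 0)}"

lemma orthogonal_pairs_indep:
  assumes "(u, w) \<in> orthogonal_pairs X" "b \<in> GF q" "c \<in> GF q" "b *s u + c *s w = 0"
  shows "b = 0 \<and> c = 0"
  using assms unfolding orthogonal_pairs_def by blast

lemma orthogonal_pairs_swap: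
  "(u, w) \<in> orthogonal_pairs X \<Longrightarrow> (w, u) \<in> orthogonal_pairs X"
  by (auto simp: orthogonal_pairs_def symp_skew[of w u] add.commute)

lemma orthogonal_pairs_scale:
  assumes "Fq_subspace q X" "(u, w) \<in> orthogonal_pairs X" "b \<in> GF q" "b \<noteq> 0"
  shows "(b *s u, w) \<in> orthogonal_pairs X"
proof -
  have "a = 0 \<and> c = 0" if "a *s (b *s u) + c *s w = 0" "a \<in> GF q" "c \<in> GF q" for a c
  proof -
    have "a * b = 0 \<and> c = 0"
      using orthogonal_pairs_indep[OF assms(2), of "a * b" c] assms(3) that by auto
    then show ?thesis using assms(4) by simp
  qed
  then show ?thesis
    using assms by (auto simp: orthogonal_pairs_def symp_scale_left Fq_subspace_def)
qed

lemma orthogonal_pairs_add: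
  assumes "Fq_subspace q X" "(u, w) \<in> orthogonal_pairs X" "c \<in> GF q"
  shows "(u + c *s w, w) \<in> orthogonal_pairs X"
proof -
  have "b = 0 \<and> a = 0" if "b *s (u + c *s w) + a *s w = 0" "b \<in> GF q" "a \<in> GF q" for a b
  proof -
    have "b *s u + (b * c + a) *s w = 0"
      using that(1) by (simp add: vec_eq_iff algebra_simps)
    then have "b = 0 \<and> b * c + a = 0"
      using orthogonal_pairs_indep[OF assms(2), of b "b * c + a"] assms(3) that by auto
    then show ?thesis by auto
  qed
  then show ?thesis
    using assms by (auto simp: orthogonal_pairs_def Fq_subspace_def symp_add_left symp_scale_left)
qed

text \<open>Any nonzero combination of \<open>u\<close> and \<open>w\<close> can be made the first
  member of another basis of the same span; this change of basis permutes the orthogonal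
  pairs.\<close>

lemma orthogonal_pairs_combination:
  fixes g :: "'a ^ 'n \<Rightarrow> nat"
  assumes X: "Fq_subspace q X" and bc: "b \<in> GF q" "c \<in> GF q" "b \<noteq> 0 \<or> c \<noteq> 0"
  shows "(\<Sum>(u, w)\<in>orthogonal_pairs X. g (b *s u + c *s w)) = (\<Sum>(u, w)\<in>orthogonal_pairs X. g u)"
proof (cases "b = 0")
  case False
  then have inv: "inverse b \<in> GF q" "inverse b \<noteq> 0" "- (c / b) \<in> GF q" "c / b \<in> GF q"
    using bc by auto
  have eq: "inverse b *s (b *s u + c *s w) + (- (c / b)) *s w = u"
    "b *s (inverse b *s u + (- (c / b)) *s w) + c *s w = u"
    "b *s (u + (c / b) *s w) = b *s u + c *s w" for u w :: "'a ^ 'n"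
    using False by (simp_all add: vec_eq_iff field_simps)
  show ?thesis
    by (rule sum.reindex_bij_witness[of _
          "\<lambda>(x, w). (inverse b *s x + (- (c / b)) *s w, w)" "\<lambda>(u, w). (b *s (u + (c / b) *s w), w)"])
      (use False bc(1,2) inv in \<open>auto simp only: eq case_prod_conv
          intro!: orthogonal_pairs_add orthogonal_pairs_scale X\<close>)
next
  case True
  then have "c \<noteq> 0" "inverse c \<in> GF q" using bc by auto
  \<comment> \<open>For \<open>b = 0\<close> the combination is a multiple of \<open>w\<close>, so
    the two members are also exchanged.\<close>
  show ?thesis
    by (rule sum.reindex_bij_witness[of _
          "\<lambda>(x, u). (u, inverse c *s x)" "\<lambda>(u, w). (c *s w, u)"])
      (use True \<open>c \<noteq> 0\<close> \<open>inverse c \<in> GF q\<close> bc in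
        \<open>auto intro: orthogonal_pairs_swap orthogonal_pairs_swap[OF orthogonal_pairs_scale[OF X]]
          orthogonal_pairs_scale[OF X orthogonal_pairs_swap]\<close>)
qed

text \<open>For fixed nonzero \<open>u\<close>, nondegeneracy of \<open>X\<close> leaves
  \<open>q ^ 3\<close> vectors of \<open>X\<close> orthogonal to \<open>u\<close>, of which the
  \<open>q\<close> multiples of \<open>u\<close> are excluded as partners.\<close>

lemma sum_orthogonal_pairs_fst:
  fixes g :: "'a ^ 'n \<Rightarrow> nat"
  assumes X: "Fq_subspace q X" and nondeg: "X \<inter> perp X = {0}" and card: "card X = q ^ 4"
  shows "(\<Sum>(u, w)\<in>orthogonal_pairs X. g u) = (q ^ 3 - q) * (\<Sum>u\<in>X - {0}. g u)"
proof -
  have "(u, w) \<in> orthogonal_pairs X \<longleftrightarrow>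
      u \<in> X \<and> u \<noteq> 0 \<and> w \<in> X \<and> symp q \<mu> w u = 0 \<and> w \<notin> Fq_line q u" for u w
  proof (intro iffI; (elim conjE)?)
    assume uw: "(u, w) \<in> orthogonal_pairs X"
    have "u \<noteq> 0"
    proof
      assume "u = 0"
      then have "1 *s u + 0 *s w = 0" by simp
      then show False
        using orthogonal_pairs_indep[OF uw, of 1 0] q_pos by simp
    qed
    moreover have "w \<notin> Fq_line q u"
    proof
      assume "w \<in> Fq_line q u"
      then obtain c where c: "c \<in> GF q" "w = c *s u" by (auto simp: Fq_line_def)
      then have "c *s u + (- 1) *s w = 0" "- 1 \<in> (GF q :: 'a set)" using GF_minus[OF one_in_GF] by auto
      then show False using orthogonal_pairs_indep[OF uw c(1), of "- 1"] by simp
    qed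
    ultimately show "u \<in> X \<and> u \<noteq> 0 \<and> w \<in> X \<and> symp q \<mu> w u = 0 \<and> w \<notin> Fq_line q u"
      using uw by (auto simp: orthogonal_pairs_def symp_skew[of w u])
  next
    assume uw: "u \<in> X" "u \<noteq> 0" "w \<in> X" "symp q \<mu> w u = 0" "w \<notin> Fq_line q u"
    have "b = 0 \<and> c = 0" if "b \<in> GF q" "c \<in> GF q" "b *s u + c *s w = 0" for b c
    proof -
      have "c = 0"
      proof (rule ccontr)
        assume "c \<noteq> 0"
        then have "w = (- (b / c)) *s u"
          using that(3) by (simp add: vec_eq_iff field_simps eq_neg_iff_add_eq_0)
        moreover have "- (b / c) \<in> GF q" using that by auto
        ultimately show False using uw(5) by (auto simp: Fq_line_def)
      qed
      then show ?thesis using that(3) uw(2) by auto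
    qed
    then show "(u, w) \<in> orthogonal_pairs X"
      using uw by (auto simp: orthogonal_pairs_def symp_skew[of w u])
  qed
  then have "orthogonal_pairs X = (SIGMA u : X - {0}. {w \<in> X. symp q \<mu> w u = 0} - Fq_line q u)"
    by auto
  note pairs = this
  have fibre: "card ({w \<in> X. symp q \<mu> w u = 0} - Fq_line q u) = q ^ 3 - q" if "u \<in> X - {0}" for u
  proof -
    have line: "Fq_line q u \<subseteq> {w \<in> X. symp q \<mu> w u = 0}"
      using X that by (auto simp: Fq_line_def Fq_subspace_def symp_scale_left)
    have "card (Fq_line q u) = q"
      using that by (simp add: card_Fq_line card_GF_q)
    moreover have "u \<notin> perp X" using that nondeg by auto
    then have "card X = q * card {w \<in> X. symp q \<mu> w u = 0}"
      by (intro card_kernel[OF X]) (auto simp: perp_def)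
    then have "card {w \<in> X. symp q \<mu> w u = 0} = q ^ 3"
      using card q_pos by (simp add: eval_nat_numeral)
    ultimately show ?thesis
      using card_Diff_subset[OF _ line] by simp
  qed
  have "(\<Sum>(u, w)\<in>orthogonal_pairs X. g u) =
      (\<Sum>u\<in>X - {0}. \<Sum>w\<in>{w \<in> X. symp q \<mu> w u = 0} - Fq_line q u. g u)"
    unfolding pairs by (subst sum.Sigma) auto
  also have "\<dots> = (\<Sum>u\<in>X - {0}. (q ^ 3 - q) * g u)"
    using fibre by (intro sum.cong) simp_all
  finally show ?thesis by (simp add: sum_distrib_left)
qed

lemma card_orthogonal_pairs:
  fixes X :: "('a ^ 'n) set"
  assumes "Fq_subspace q X" "X \<inter> perp X = {0}" "card X = q ^ 4"
  shows "card (orthogonal_pairs X) = (q ^ 3 - q) * (q ^ 4 - 1)"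
proof -
  have "0 \<in> X" using assms by (simp add: Fq_subspace_def)
  then show ?thesis
    using sum_orthogonal_pairs_fst[OF assms, of "\<lambda>_. 1"] assms(3)
    by (simp add: case_prod_unfold card_Diff_singleton)
qed

text \<open>The spans of the orthogonal pairs cover the nonzero vectors of \<open>X\<close>
  uniformly, while every span contains 0. The term with \<open>g 0\<close> records this excess at
  the origin.\<close>

lemma sum_orthogonal_pairs:
  fixes g :: "'a ^ 'n \<Rightarrow> nat"
  assumes X: "Fq_subspace q X" "X \<inter> perp X = {0}" "card X = q ^ 4"
  shows "(\<Sum>(u, w)\<in>orthogonal_pairs X. \<Sum>(b, c)\<in>GF q \<times> GF q. g (b *s u + c *s w)) =
    (q ^ 2 - 1) * (q ^ 3 - q) * (sum g X + q ^ 2 * g 0)"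
proof -
  let ?Q = "orthogonal_pairs X" and ?D = "q ^ 3 - q"
  have zero: "0 \<in> X" "(0 :: 'a) \<in> GF q" using X q_pos by (simp_all add: Fq_subspace_def)
  have "q ^ 4 = q ^ 2 * q ^ 2" by (simp flip: power_add)
  then have q4: "q ^ 4 - 1 = (q ^ 2 - 1) * (1 + q ^ 2)"
    by (cases "q ^ 2") simp_all
  have "(\<Sum>(u, w)\<in>?Q. \<Sum>(b, c)\<in>GF q \<times> GF q. g (b *s u + c *s w)) =
      (\<Sum>(b, c)\<in>GF q \<times> GF q. \<Sum>(u, w)\<in>?Q. g (b *s u + c *s w))"
    unfolding case_prod_unfold by (rule sum.swap)
  \<comment> \<open>The coefficients \<open>(0, 0)\<close> are split off; each of the other
    \<open>q ^ 2 - 1\<close> coefficient pairs contributes the same amount.\<close>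
  also have "\<dots> = card ?Q * g 0 +
      (\<Sum>(b, c)\<in>GF q \<times> GF q - {(0, 0)}. \<Sum>(u, w)\<in>?Q. g (b *s u + c *s w))"
    using zero by (subst sum.remove[of _ "(0, 0)"]) (auto simp: case_prod_unfold)
  also have "(\<Sum>(b, c)\<in>GF q \<times> GF q - {(0, 0)}. \<Sum>(u, w)\<in>?Q. g (b *s u + c *s w)) =
      (\<Sum>_\<in>GF q \<times> GF q - {(0 :: 'a, 0 :: 'a)}. ?D * sum g (X - {0}))"
    using orthogonal_pairs_combination[OF X(1)] sum_orthogonal_pairs_fst[OF X]
    by (intro sum.cong[OF refl]) (simp only: Diff_iff mem_Sigma_iff singleton_iff split_paired_all
      prod.inject case_prod_conv de_Morgan_conj)
  also have "\<dots> = (q ^ 2 - 1) * (?D * sum g (X - {0}))"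
    using zero by (simp add: card_Diff_singleton card_cartesian_product card_GF_q power2_eq_square)
  also have "card ?Q = (q ^ 2 - 1) * ?D * (1 + q ^ 2)"
    unfolding card_orthogonal_pairs[OF X] q4 by (simp only: mult_ac)
  also have "sum g X = g 0 + sum g (X - {0})"
    using zero by (intro sum.remove) auto
  then have "(q ^ 2 - 1) * ?D * (1 + q ^ 2) * g 0 + (q ^ 2 - 1) * (?D * sum g (X - {0})) =
      (q ^ 2 - 1) * ?D * (sum g X + q ^ 2 * g 0)"
    by (simp only: distrib_left distrib_right mult_1_left mult_1_right ac_simps)
  finally show ?thesis .
qed

section \<open>The one-dimensional Hermitian space\<close>

lemma herm_dim1: "herm q x y = x $ 1 * (y $ 1) ^ (q ^ 3)" for x y :: "'a ^ 1"
  by (simp add: herm_def)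

lemma symp_scales:
  "symp q \<mu> (c *s v) (d *s (v :: 'a ^ 'n)) = tr (\<mu> * (c * d ^ (q ^ 3) * herm q v v))"
  by (simp add: symp_eq herm_scale_left herm_scale_right mult_ac)

text \<open>On such a line the Hermitian form takes values in \<open>GF (q ^ 3)\<close>, where
  multiplication by \<open>\<mu>\<close> followed by the trace gives zero. This supplies the planes
  \<open>GF (q^3) v\<close>.\<close>

lemma totally_isotropic_K_line: "totally_isotropic q (symp q \<mu>) (Fq_line (q ^ 3) (v :: 'a ^ 'n))"
proof -
  have "symp q \<mu> (c *s v) (d *s v) = 0" if "c \<in> GF (q ^ 3)" "d \<in> GF (q ^ 3)" for c d
  proof -
    have "d ^ (q ^ 3) = d" using that(2) by (simp add: GF_def)
    then show ?thesis
      using that herm_self_in_GF[of v] by (simp add: symp_scales tr_mult_GF_eq_0 GF_mult)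
  qed
  then show ?thesis
    using Fq_subspace_Fq_line by (auto simp: totally_isotropic_def Fq_line_def)
qed

lemma card_perp_line:
  assumes "z \<noteq> (0 :: 'a ^ 1)"
  shows "card (perp (Fq_line (q ^ 2) z)) = q ^ 4"
proof -
  have "q ^ 2 * card (perp (Fq_line (q ^ 2) z)) = q ^ 2 * q ^ 4"
    using card_perp[OF Fq_subspace_Fq_line[of 2 z]] assms
    by (simp add: card_Fq_line card_GF_q card_field flip: power_add)
  then show ?thesis
    by (simp only: nat_mult_eq_cancel1 zero_less_power q_pos)
qed

lemma card_norm_values:
  assumes "\<T> \<subseteq> GF (q ^ 3) - {0}"
  shows "card {v :: 'a ^ 1. herm q v v \<in> \<T>} = card \<T> * (q ^ 3 + 1)"
proof -
  have "bij_betw (\<lambda>v :: 'a ^ 1. v $ 1) {v. herm q v v \<in> \<T>} {x. x * x ^ (q ^ 3) \<in> \<T>}"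
    by (rule bij_betw_byWitness[where f' = vec]) (auto simp: herm_dim1 vec_eq_iff)
  then have "card {v :: 'a ^ 1. herm q v v \<in> \<T>} = card {x. x * x ^ (q ^ 3) \<in> \<T>}"
    by (rule bij_betw_same_card)
  also have "{x. x * x ^ (q ^ 3) \<in> \<T>} = (\<Union>t\<in>\<T>. {x. x * x ^ (q ^ 3) = t})" by auto
  also have "card \<dots> = (\<Sum>t\<in>\<T>. card {x. x * x ^ (q ^ 3) = t})"
    by (rule card_UN_disjoint) auto
  also have "\<dots> = (\<Sum>t\<in>\<T>. q ^ 3 + 1)"
    using assms by (intro sum.cong[OF refl] card_norm_fibre) auto
  finally show ?thesis by simp
qed

end

text \<open>This records the outcome of the reduction to dimension one, with \<open>C\<close> as the
  common count on all totally isotropic planes.\<close>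

locale constant_on_planes = trace_form q \<mu> for q and \<mu> :: "'a::{field,finite}" +
  fixes \<T> :: "'a set" and C :: nat
  assumes \<T>_subset: "\<T> \<subseteq> GF (q ^ 3) - {0}"
    and \<T>_invariant: "invariant_under (GF q - {0}) \<T>"
    and plane: "\<And>\<pi> :: ('a ^ 1) set. totally_isotropic q (symp q \<mu>) \<pi> \<Longrightarrow> card \<pi> = q ^ 3
      \<Longrightarrow> card {v \<in> \<pi>. herm q v v \<in> \<T>} = C"
begin

definition f :: "'a ^ 1 \<Rightarrow> nat" where
  "f v = of_bool (herm q v v \<in> \<T>)"

lemma sum_f: "sum f A = card {v \<in> A. herm q v v \<in> \<T>}"
  by (simp add: f_def Int_def)

lemma f_0 [simp]: "f 0 = 0"
  using \<T>_subset q_pos by (auto simp: f_def herm_dim1 power_0_left)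

lemma sum_f_plane:
  "totally_isotropic q (symp q \<mu>) \<pi> \<Longrightarrow> card \<pi> = q ^ 3 \<Longrightarrow> sum f \<pi> = C"
  by (simp only: sum_f plane)

text \<open>The planes \<open>GF (q^3) v\<close> partition the nonzero vectors.\<close>

lemma C_eq: "C = card \<T>"
proof -
  let ?A = "{v :: 'a ^ 1. herm q v v \<in> \<T>}" and ?V = "UNIV - {0 :: 'a ^ 1}"
  have cardV: "card ?V = (q ^ 3 + 1) * (q ^ 3 - 1)"
  proof -
    have "q ^ 6 = q ^ 3 * q ^ 3" by (simp flip: power_add)
    then show ?thesis
      by (cases "q ^ 3") (simp_all add: card_Diff_singleton card_field)
  qed
  have K: "card (GF (q ^ 3) - {0 :: 'a}) = q ^ 3 - 1"
    using q_pos by (simp add: card_Diff_singleton card_GF_q)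
  \<comment> \<open>Double count of the pairs of a nonzero \<open>a\<close> and a vector
    \<open>v\<close> with norm in \<open>\<T>\<close> on the plane spanned by
    \<open>a\<close>.\<close>
  have "card ?V * C = (\<Sum>a\<in>?V. card {v \<in> Fq_line (q ^ 3) a. herm q v v \<in> \<T>})"
    using plane[OF totally_isotropic_K_line] by (simp add: card_Fq_line card_GF_q)
  also have "\<dots> = (\<Sum>a\<in>?V. \<Sum>v | v \<in> ?A \<and> v \<in> Fq_line (q ^ 3) a. 1)"
    by (simp add: conj_commute)
  also have "\<dots> = (\<Sum>v\<in>?A. \<Sum>a | a \<in> ?V \<and> v \<in> Fq_line (q ^ 3) a. 1)"
    by (rule sum.swap_restrict) auto
  also have "\<dots> = (\<Sum>v\<in>?A. q ^ 3 - 1)"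
  proof (rule sum.cong[OF refl])
    fix v assume "v \<in> ?A"
    then have v: "v \<noteq> 0" using f_0 by (auto simp: f_def)
    \<comment> \<open>The vectors whose plane contains \<open>v\<close> are its nonzero
      \<open>GF (q ^ 3)\<close>-multiples.\<close>
    have "{a. a \<in> ?V \<and> v \<in> Fq_line (q ^ 3) a} = (\<lambda>c. c *s v) ` (GF (q ^ 3) - {0})"
    proof (intro equalityI subsetI)
      fix a assume "a \<in> {a. a \<in> ?V \<and> v \<in> Fq_line (q ^ 3) a}"
      then obtain c where c: "c \<in> GF (q ^ 3)" "v = c *s a" by (auto simp: Fq_line_def)
      then have "a = inverse c *s v" "c \<noteq> 0" using v by (auto simp: vec_eq_iff)
      then show "a \<in> (\<lambda>c. c *s v) ` (GF (q ^ 3) - {0})"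
        using c(1) by (intro image_eqI[of _ _ "inverse c"]) auto
    next
      fix a assume "a \<in> (\<lambda>c. c *s v) ` (GF (q ^ 3) - {0})"
      then obtain c where c: "c \<in> GF (q ^ 3)" "c \<noteq> 0" "a = c *s v" by auto
      then have "v = inverse c *s a" by (simp add: vec_eq_iff)
      then have "v \<in> Fq_line (q ^ 3) a"
        using GF_inverse[OF c(1)] unfolding Fq_line_def by blast
      then show "a \<in> {a. a \<in> ?V \<and> v \<in> Fq_line (q ^ 3) a}"
        using c v by auto
    qed
    moreover have "inj_on (\<lambda>c. c *s v) (GF (q ^ 3) - {0})"
      using v by (auto simp: inj_on_def vector_mul_rcancel)
    ultimately show "(\<Sum>a | a \<in> ?V \<and> v \<in> Fq_line (q ^ 3) a. 1) = q ^ 3 - 1"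
      using K by (simp add: card_image)
  qed
  also have "\<dots> = card \<T> * (q ^ 3 + 1) * (q ^ 3 - 1)"
    using card_norm_values[OF \<T>_subset] by simp
  finally have "(q ^ 3 + 1) * (q ^ 3 - 1) * C = (q ^ 3 + 1) * (q ^ 3 - 1) * card \<T>"
    unfolding cardV by (simp only: mult_ac)
  moreover have "q ^ 3 > 1" using q_gt_1 by (intro one_less_power) auto
  ultimately show ?thesis by simp
qed

text \<open>For \<open>c\<close> in \<open>GF (q ^ 2)\<close> the power \<open>q ^ 3\<close> acts as
  the power \<open>q\<close>, so the norm of \<open>c\<close> is \<open>c ^ (q + 1)\<close>, an
  element of \<open>GF q\<close>.\<close>

lemma f_on_line:
  assumes "f z = 1" "v \<in> Fq_line (q ^ 2) z" "v \<noteq> 0"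
  shows "f v = 1"
proof -
  obtain c where c: "c \<in> GF (q ^ 2)" "v = c *s z" using assms by (auto simp: Fq_line_def)
  then have "c \<noteq> 0" using assms(3) by auto
  have cq: "c ^ (q ^ 2) = c" using c by (simp add: GF_def)
  then have "c ^ (q ^ 3) = c ^ q"
    by (simp add: power3_eq_cube power2_eq_square power_mult)
  then have "c * c ^ (q ^ 3) \<in> GF q"
    using cq by (simp add: GF_def power_mult_distrib power2_eq_square flip: power_mult)
  moreover have "herm q z z \<in> \<T>"
    using assms(1) by (simp add: f_def of_bool_def split: if_splits)
  ultimately show ?thesis
    using \<T>_invariant \<open>c \<noteq> 0\<close>
    by (auto simp: f_def c(2) herm_self_scale invariant_under_def)
qed

lemma line_sum:
  assumes "f z = 1"
  shows "sum f (Fq_line (q ^ 2) z - {0}) = q ^ 2 - 1"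
proof -
  have "z \<noteq> 0" "0 \<in> Fq_line (q ^ 2) z"
    using assms Fq_subspace_Fq_line[of 2 z] by (auto simp: Fq_subspace_def)
  then show ?thesis
    using f_on_line[OF assms] by (simp add: card_Diff_singleton card_Fq_line card_GF_q)
qed

lemma isotropic_line_bound:
  assumes z: "f z = 1" and iso: "totally_isotropic q (symp q \<mu>) (Fq_line (q ^ 2) z)"
  shows "q * (q - 1) \<le> C"
proof -
  define l where "l = Fq_line (q ^ 2) z"
  have "z \<noteq> 0" using z by auto
  have l: "Fq_subspace q l" "card l = q ^ 2"
    using \<open>z \<noteq> 0\<close> by (simp_all add: l_def Fq_subspace_Fq_line card_Fq_line card_GF_q)
  have "card (perp l) = q ^ 4" using \<open>z \<noteq> 0\<close> by (simp add: l_def card_perp_line)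
  moreover have "q ^ 2 < q ^ 4" using q_gt_1 by (intro power_strict_increasing) auto
  \<comment> \<open>The orthogonal space is larger than the line, so a vector \<open>w\<close>
    outside \<open>l\<close> extends \<open>l\<close> to a totally isotropic plane.\<close>
  ultimately have "\<not> perp l \<subseteq> l" using l(2) card_mono[of l "perp l"] by auto
  then obtain w where w: "w \<in> perp l" "w \<notin> l" by blast
  define \<pi> where "\<pi> = subspace_sum l (Fq_line q w)"
  have zero: "0 \<in> l" "0 \<in> Fq_line q w"
    using l(1) q_pos by (auto simp: Fq_subspace_def Fq_line_def intro: exI[of _ 0])
  have "l \<inter> Fq_line q w = {0}"
  proof -
    have "c *s w = 0" if "c *s w \<in> l" "c \<in> GF q" for c
    proof (rule ccontr)
      assume "c *s w \<noteq> 0"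
      then have "w = inverse c *s (c *s w)" by auto
      moreover have "inverse c *s (c *s w) \<in> l"
        using l(1) that GF_inverse unfolding Fq_subspace_def by blast
      ultimately show False using w(2) by simp
    qed
    then show ?thesis using zero by (auto simp: Fq_line_def)
  qed
  moreover have "w \<noteq> 0" using w zero by auto
  ultimately have "card \<pi> = q ^ 3"
    using Fq_subspace_Fq_line[of 1 w] l
    by (simp add: \<pi>_def card_subspace_sum card_Fq_line card_GF_q eval_nat_numeral)
  moreover have "Fq_line q w \<subseteq> perp l"
    using w(1) Fq_subspace_perp[of l] by (auto simp: Fq_line_def Fq_subspace_def)
  then have "totally_isotropic q (symp q \<mu>) \<pi>"
    unfolding \<pi>_def using iso
    by (intro totally_isotropic_subspace_sum totally_isotropic_Fq_line) (simp_all add: l_def)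
  ultimately have "sum f \<pi> = C" using sum_f_plane by blast
  moreover have "l - {0} \<subseteq> \<pi>"
  proof
    fix y assume "y \<in> l - {0}"
    then show "y \<in> \<pi>"
      unfolding \<pi>_def subspace_sum_def using zero by (intro image_eqI[of _ _ "(y, 0)"]) auto
  qed
  then have "sum f (l - {0}) \<le> sum f \<pi>" by (intro sum_mono2) auto
  ultimately have "q ^ 2 - 1 \<le> C" using line_sum[OF z] by (simp add: l_def)
  moreover have "q * (q - 1) \<le> q ^ 2 - 1"
    using q_gt_1 by (simp add: power2_eq_square diff_mult_distrib2)
  ultimately show ?thesis by simp
qed

text \<open>The radical of the line is closed under multiplication by \<open>GF (q ^ 2)\<close>, so
  it is either zero or the whole line.\<close>

lemma nondegenerate_if_not_isotropic:
  assumes "\<not> totally_isotropic q (symp q \<mu>) (Fq_line (q ^ 2) z)"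
  shows "Fq_line (q ^ 2) z \<inter> perp (Fq_line (q ^ 2) z) = {0 :: 'a ^ 'n}"
proof -
  let ?l = "Fq_line (q ^ 2) z"
  have "c *s z = 0" if c: "c \<in> GF (q ^ 2)" "c *s z \<in> perp ?l" for c
  proof (rule ccontr)
    assume "c *s z \<noteq> 0"
    then have "c \<noteq> 0" by auto
    have "symp q \<mu> (a *s z) (b *s z) = 0" if "a \<in> GF (q ^ 2)" "b \<in> GF (q ^ 2)" for a b
    proof -
      \<comment> \<open>With this factor the pairing of \<open>a *s z\<close> and
        \<open>b *s z\<close> equals that of \<open>e *s z\<close> and \<open>c *s z\<close>, which
        vanishes.\<close>
      define e where "e = a * b ^ (q ^ 3) / c ^ (q ^ 3)"
      have "e \<in> GF (q ^ 2)" using that c(1) by (auto simp: e_def)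
      then have "symp q \<mu> (e *s z) (c *s z) = 0"
        using c(2) by (auto simp: perp_def Fq_line_def)
      moreover have "e * c ^ (q ^ 3) = a * b ^ (q ^ 3)"
        using \<open>c \<noteq> 0\<close> by (simp add: e_def)
      ultimately show ?thesis by (simp add: symp_scales)
    qed
    then show False
      using assms Fq_subspace_Fq_line by (auto simp: totally_isotropic_def Fq_line_def)
  qed
  moreover have "0 \<in> ?l" "0 \<in> perp ?l"
    using Fq_subspace_Fq_line[of 2 z] Fq_subspace_perp[of ?l] by (simp_all add: Fq_subspace_def)
  ultimately show ?thesis by (auto simp: Fq_line_def)
qed

text \<open>
  In the nondegenerate case \<open>V\<close> is the orthogonal sum of the line \<open>l\<close> and \<open>X = perp l\<close>. The planes
  spanned by a vector of \<open>l\<close> and an orthogonal pair of \<open>X\<close> cover \<open>V\<close> uniformly, except for an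
  excess on \<open>X\<close> and \<open>l\<close>. Comparing with the uniform covering by the planes \<open>GF (q^3) v\<close> leaves
  \<open>f X + q * f l = (q + 1) * C\<close>.
\<close>

lemma nondegenerate_line_bound:
  assumes z: "f z = 1" and nondeg: "Fq_line (q ^ 2) z \<inter> perp (Fq_line (q ^ 2) z) = {0}"
  shows "q * (q - 1) \<le> C"
proof -
  define l where "l = Fq_line (q ^ 2) z"
  define X where "X = perp l"
  have "z \<noteq> 0" using z by auto
  have l: "Fq_subspace q l" "card l = q ^ 2"
    using \<open>z \<noteq> 0\<close> by (simp_all add: l_def Fq_subspace_Fq_line card_Fq_line card_GF_q)
  have X: "Fq_subspace q X" by (simp add: X_def Fq_subspace_perp)
  have lX: "l \<inter> X = {0}" using nondeg by (simp add: l_def X_def)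
  have zero: "0 \<in> l" "0 \<in> X" "(0 :: 'a) \<in> GF q" using lX q_pos by auto
  have cardX: "card X = q ^ 4" using \<open>z \<noteq> 0\<close> by (simp add: X_def l_def card_perp_line)
  have "card (subspace_sum l X) = CARD('a ^ 1)"
    using card_subspace_sum[OF l(1) X lX] by (simp add: l(2) cardX card_field flip: power_add)
  then have V: "subspace_sum l X = UNIV"
    by (intro card_eq_UNIV_imp_eq_UNIV) auto
  have orth: "symp q \<mu> y x = 0" "symp q \<mu> x y = 0" if "y \<in> l" "x \<in> X" for x y
    using that symp_skew[of x y] by (auto simp: X_def perp_def)
  \<comment> \<open>A vector of \<open>X\<close> orthogonal to \<open>X\<close> is also orthogonal
    to \<open>l\<close>, hence to the whole space.\<close>
  have "v = 0" if "v \<in> X" "v \<in> perp X" for v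
  proof (rule ccontr)
    assume "v \<noteq> 0"
    then obtain y where y: "symp q \<mu> y v \<noteq> 0" using symp_nondegenerate by blast
    have "y \<in> subspace_sum l X" by (simp add: V)
    then obtain a b where "a \<in> l" "b \<in> X" "y = a + b"
      by (auto simp: subspace_sum_def)
    then show False using y that orth by (auto simp: symp_add_left perp_def)
  qed
  then have XX: "X \<inter> perp X = {0}"
    using zero Fq_subspace_perp[of X] by (auto simp: Fq_subspace_def)
  let ?Q = "orthogonal_pairs X" and ?D = "(q ^ 3 - q) * (q ^ 2 - 1)"
  have D: "?D > 0"
  proof -
    have "q ^ 1 < q ^ 3" "q ^ 0 < q ^ 2"
      using q_gt_1 by (intro power_strict_increasing; simp)+
    then show ?thesis by simp
  qed
  have q4: "q ^ 4 - 1 = (q ^ 2 - 1) * (q ^ 2 + 1)"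
  proof -
    have "q ^ 4 = q ^ 2 * q ^ 2" by (simp flip: power_add)
    then show ?thesis by (cases "q ^ 2") simp_all
  qed

  \<comment> \<open>The vectors \<open>p\<close>, \<open>u\<close> and \<open>w\<close> span a
    totally isotropic plane, and the coefficients run through its vectors once each.\<close>
  have plane: "(\<Sum>a\<in>GF q. \<Sum>(b, c)\<in>GF q \<times> GF q. f (a *s p + (b *s u + c *s w))) = C"
    if p: "p \<in> l - {0}" and uw: "(u, w) \<in> ?Q" for p u w
  proof -
    note indep = orthogonal_pairs_indep[OF uw]
    have mem: "u \<in> X" "w \<in> X" "symp q \<mu> u w = 0"
      using uw by (auto simp: orthogonal_pairs_def)
    have nz: "u \<noteq> 0" "w \<noteq> 0"
      using indep[of 1 0] indep[of 0 1] zero by auto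
    note lines = Fq_subspace_Fq_line[of 1, simplified]
    have uw0: "Fq_line q u \<inter> Fq_line q w = {0}"
    proof -
      have "b *s u = 0" if "b \<in> GF q" "c \<in> GF q" "b *s u = c *s w" for b c
        using indep[of b "- c"] that by auto
      moreover have "0 \<in> Fq_line q u" "0 \<in> Fq_line q w" using lines by (auto simp: Fq_subspace_def)
      ultimately show ?thesis by (auto simp: Fq_line_def)
    qed
    define W where "W = subspace_sum (Fq_line q u) (Fq_line q w)"
    have "Fq_line q w \<subseteq> perp (Fq_line q u)"
      using mem(3) by (auto simp: perp_def Fq_line_def symp_scale_left symp_scale_right)
    then have W: "totally_isotropic q (symp q \<mu>) W"
      unfolding W_def by (intro totally_isotropic_subspace_sum totally_isotropic_Fq_line)
    have WX: "W \<subseteq> X"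
      using mem X by (auto simp: W_def subspace_sum_def Fq_line_def Fq_subspace_def)
    have pl: "Fq_line q p \<subseteq> l"
      using p l(1) by (auto simp: Fq_line_def Fq_subspace_def)
    have pW: "Fq_line q p \<inter> W = {0}"
      using WX pl lX lines[of p] W by (auto simp: Fq_subspace_def totally_isotropic_def)
    have "W \<subseteq> perp (Fq_line q p)"
      using WX pl orth by (auto simp: perp_def)
    then have iso: "totally_isotropic q (symp q \<mu>) (subspace_sum (Fq_line q p) W)"
      using W by (intro totally_isotropic_subspace_sum totally_isotropic_Fq_line)
    have W': "Fq_subspace q W" using W by (simp add: totally_isotropic_def)
    have "card W = q * q"
      unfolding W_def using card_subspace_sum[OF lines lines uw0] nz
      by (simp add: card_Fq_line card_GF_q)
    then have "card (subspace_sum (Fq_line q p) W) = q ^ 3"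
      using card_subspace_sum[OF lines W' pW] p by (simp add: card_Fq_line card_GF_q power3_eq_cube)
    with iso have "C = sum f (subspace_sum (Fq_line q p) W)" by (rule sum_f_plane[symmetric])
    also have "\<dots> = (\<Sum>a\<in>GF q. \<Sum>y\<in>W. f (a *s p + y))"
      using p by (simp add: sum_subspace_sum[OF lines W' pW] sum_Fq_line)
    also have "\<dots> = (\<Sum>a\<in>GF q. \<Sum>b\<in>GF q. \<Sum>c\<in>GF q. f (a *s p + (b *s u + c *s w)))"
      using nz by (simp add: W_def sum_subspace_sum[OF lines lines uw0] sum_Fq_line)
    finally show ?thesis by (simp add: sum.cartesian_product)
  qed

  \<comment> \<open>Up to the factor \<open>?D\<close>, this is the sum over all orthogonal pairs
    for fixed \<open>y\<close>: the coset \<open>y + X\<close> is covered uniformly, with an excess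
    at \<open>y\<close> from the zero in every span.\<close>
  define G where "G y = (\<Sum>x\<in>X. f (y + x)) + q ^ 2 * f y" for y
  have inner: "(\<Sum>(u, w)\<in>?Q. \<Sum>a\<in>GF q. \<Sum>(b, c)\<in>GF q \<times> GF q. f (a *s p + (b *s u + c *s w)))
      = ?D * (\<Sum>a\<in>GF q. G (a *s p))" for p
  proof -
    have "(\<Sum>(u, w)\<in>?Q. \<Sum>a\<in>GF q. \<Sum>(b, c)\<in>GF q \<times> GF q. f (a *s p + (b *s u + c *s w))) =
        (\<Sum>a\<in>GF q. \<Sum>(u, w)\<in>?Q. \<Sum>(b, c)\<in>GF q \<times> GF q. f (a *s p + (b *s u + c *s w)))"
      unfolding case_prod_unfold by (rule sum.swap)
    also have "\<dots> = (\<Sum>a\<in>GF q. ?D * G (a *s p))"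
      using sum_orthogonal_pairs[OF X XX cardX, of "\<lambda>x. f (_ *s p + x)"]
      by (intro sum.cong[OF refl]) (simp add: G_def mult.commute[of "q ^ 2 - 1"])
    finally show ?thesis by (simp add: sum_distrib_left)
  qed
  have "?D * (\<Sum>p\<in>l - {0}. \<Sum>a\<in>GF q. G (a *s p)) = (\<Sum>p\<in>l - {0}. \<Sum>(u, w)\<in>?Q. C)"
    unfolding sum_distrib_left[of ?D _ "l - {0}"]
  proof (rule sum.cong[OF refl])
    fix p assume "p \<in> l - {0}"
    then show "?D * (\<Sum>a\<in>GF q. G (a *s p)) = (\<Sum>(u, w)\<in>?Q. C)"
      unfolding inner[symmetric] using plane by (intro sum.cong[OF refl]) auto
  qed
  also have "\<dots> = card (l - {0}) * (card ?Q * C)"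
    by (simp add: case_prod_unfold)
  also have "card (l - {0}) = q ^ 2 - 1"
    using zero by (simp add: l(2) card_Diff_singleton)
  also have "card ?Q = ?D * (q ^ 2 + 1)"
    by (simp only: card_orthogonal_pairs[OF X XX cardX] q4 mult.assoc)
  also have "(q ^ 2 - 1) * (?D * (q ^ 2 + 1) * C) = ?D * ((q ^ 2 - 1) * (q ^ 2 + 1) * C)"
    by (simp only: mult_ac)
  finally have "(\<Sum>p\<in>l - {0}. \<Sum>a\<in>GF q. G (a *s p)) = (q ^ 2 - 1) * (q ^ 2 + 1) * C"
    using D by (simp only: mult_cancel1) simp
  \<comment> \<open>The coefficient 0 yields \<open>G 0\<close> for every \<open>p\<close>; each
    nonzero coefficient permutes \<open>l - {0}\<close>.\<close>
  moreover have "(\<Sum>p\<in>l - {0}. \<Sum>a\<in>GF q. G (a *s p)) =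
      (q ^ 2 - 1) * G 0 + (q - 1) * sum G (l - {0})"
  proof -
    have "(\<Sum>p\<in>l - {0}. \<Sum>a\<in>GF q. G (a *s p)) = (\<Sum>a\<in>GF q. \<Sum>p\<in>l - {0}. G (a *s p))"
      by (rule sum.swap)
    also have "\<dots> = (\<Sum>p\<in>l - {0}. G (0 *s p)) + (\<Sum>a\<in>GF q - {0}. \<Sum>p\<in>l - {0}. G (a *s p))"
      using zero by (intro sum.remove) auto
    also have "(\<Sum>a\<in>GF q - {0}. \<Sum>p\<in>l - {0}. G (a *s p)) = (\<Sum>a\<in>GF q - {0 :: 'a}. sum G (l - {0}))"
    proof (rule sum.cong[OF refl])
      fix a :: 'a assume a: "a \<in> GF q - {0}"
      then show "(\<Sum>p\<in>l - {0}. G (a *s p)) = sum G (l - {0})"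
        using l(1) GF_inverse[of a q]
        by (intro sum.reindex_bij_witness[of _ "\<lambda>p. inverse a *s p" "\<lambda>p. a *s p"])
          (auto simp: Fq_subspace_def vector_smult_assoc)
    qed
    finally show ?thesis
      using zero by (simp add: l(2) card_Diff_singleton card_GF_q)
  qed
  moreover have "G 0 = sum f X" by (simp add: G_def)
  ultimately have eq1: "(q ^ 2 - 1) * sum f X + (q - 1) * sum G (l - {0}) = (q ^ 2 - 1) * (q ^ 2 + 1) * C"
    by simp
  \<comment> \<open>The cosets \<open>y + X\<close> with \<open>y\<close> in \<open>l\<close>
    partition the space. The last summand is \<open>q ^ 2 * sum f l\<close>.\<close>
  have eq2: "sum f X + sum G (l - {0}) = (q ^ 3 + 1) * C + q ^ 2 * (q ^ 2 - 1)"
  proof -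
    have "(\<Sum>y\<in>l. \<Sum>x\<in>X. f (y + x)) = sum f UNIV"
      using sum_subspace_sum[OF l(1) X lX, of f] by (simp add: V)
    moreover have "sum f UNIV = (q ^ 3 + 1) * C"
      using card_norm_values[OF \<T>_subset] by (simp add: sum_f C_eq)
    moreover have "sum f l = q ^ 2 - 1"
      using line_sum[OF z] sum.remove[of l 0 f] zero by (simp add: l_def)
    ultimately have "sum G l = (q ^ 3 + 1) * C + q ^ 2 * (q ^ 2 - 1)"
      by (simp add: G_def sum.distrib flip: sum_distrib_left)
    moreover have "sum G l = G 0 + sum G (l - {0})"
      using zero by (intro sum.remove) auto
    ultimately show ?thesis using \<open>G 0 = sum f X\<close> by simp
  qed
  \<comment> \<open>Cancelling \<open>r = q - 1\<close> in \<open>eq1\<close> and comparing with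
    \<open>eq2\<close> eliminates \<open>sum G (l - {0})\<close>; then a factor \<open>q\<close>
    cancels, and the nonnegative \<open>sum f X\<close> is dropped.\<close>
  obtain r where r: "q = r + 1" "r > 0" using q_gt_1 by (cases q) auto
  have q2: "q ^ 2 - 1 = r * (q + 1)"
    by (simp add: r power2_eq_square)
  have "r * ((q + 1) * sum f X + sum G (l - {0})) = r * ((q + 1) * (q ^ 2 + 1) * C)"
    using eq1 unfolding q2 by (simp add: r algebra_simps)
  then have "(q + 1) * sum f X + sum G (l - {0}) = (q + 1) * (q ^ 2 + 1) * C"
    using r(2) by simp
  with eq2 have "q * (sum f X + (q + 1) * (q * r)) = q * ((q + 1) * C)"
    unfolding q2 by (simp add: algebra_simps power2_eq_square power3_eq_cube)
  then have "sum f X + (q + 1) * (q * r) = (q + 1) * C"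
    using q_pos by simp
  then have "(q + 1) * (q * r) \<le> (q + 1) * C" by linarith
  then have "q * r \<le> C" by (simp only: mult_le_cancel1)
  then show ?thesis by (simp add: r)
qed

lemma card_\<T>_ge:
  assumes "\<T> \<noteq> {}"
  shows "q * (q - 1) \<le> card \<T>"
proof -
  obtain t where t: "t \<in> \<T>" using assms by blast
  \<comment> \<open>Every nonzero element of \<open>GF (q ^ 3)\<close> is a norm, so
    \<open>t\<close> is the norm of some vector \<open>z\<close> to which the line bounds
    apply.\<close>
  then have "card {x. x * x ^ (q ^ 3) = t} \<noteq> 0"
    using \<T>_subset by (subst card_norm_fibre) auto
  then obtain x where "x * x ^ (q ^ 3) = t"
    by (metis (mono_tags, lifting) Collect_empty_eq card.empty)
  then have "f (vec x) = 1" using t by (simp add: f_def herm_dim1)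
  then show ?thesis
    using isotropic_line_bound nondegenerate_line_bound nondegenerate_if_not_isotropic C_eq by metis
qed

end

section \<open>Counting coset representatives\<close>

text \<open>Multiplication maps \<open>S \<times> T\<close> bijectively onto \<open>\<T>\<close>:
  uniqueness of the representative determines \<open>r\<close>, and \<open>r \<noteq> 0\<close> then
  determines the factor in \<open>S\<close>.\<close>

lemma card_coset_reps:
  fixes \<T> :: "'a::{field,finite} set"
  assumes inv: "invariant_under S \<T>" and reps: "coset_reps S \<T> T" and "0 \<notin> \<T>"
  shows "card \<T> = card S * card T"
proof -
  have T: "T \<subseteq> \<T>" and ex1: "\<And>a. a \<in> \<T> \<Longrightarrow> \<exists>!r. r \<in> T \<and> (\<exists>s\<in>S. a = s * r)"
    using reps by (auto simp: coset_reps_def)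
  have "bij_betw (\<lambda>(s, r). s * r) (S \<times> T) \<T>"
    unfolding bij_betw_def
  proof
    show "inj_on (\<lambda>(s, r). s * r) (S \<times> T)"
    proof (rule inj_onI; clarify)
      fix s r s' r' assume *: "s \<in> S" "r \<in> T" "s' \<in> S" "r' \<in> T" "s * r = s' * r'"
      then have "s * r \<in> \<T>" using inv T by (auto simp: invariant_under_def)
      from ex1[OF this] have "r = r'" using * by blast
      moreover have "r \<noteq> 0" using * T \<open>0 \<notin> \<T>\<close> by auto
      ultimately show "s = s' \<and> r = r'" using * by simp
    qed
    show "(\<lambda>(s, r). s * r) ` (S \<times> T) = \<T>"
    proof (intro equalityI subsetI)
      fix a assume "a \<in> \<T>"
      then obtain r s where "r \<in> T" "s \<in> S" "a = s * r" using ex1 by blast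
      then show "a \<in> (\<lambda>(s, r). s * r) ` (S \<times> T)"
        by (intro image_eqI[of _ _ "(s, r)"]) auto
    qed (use inv T in \<open>auto simp: invariant_under_def\<close>)
  qed
  then show ?thesis
    by (simp add: bij_betw_same_card[symmetric] card_cartesian_product)
qed

text \<open>For odd \<open>q\<close> the nonzero squares are roots of \<open>x ^ k = 1\<close> with
  \<open>k = (q - 1) / 2\<close>, which gives half of the general bound.\<close>

lemma (in trace_form) card_squares_le:
  "card (squares q :: 'a set) \<le> q - 1" "odd q \<Longrightarrow> 2 * card (squares q :: 'a set) \<le> q - 1"
proof -
  have "squares q = (\<lambda>c :: 'a. c ^ 2) ` (GF q - {0})"
    by (auto simp: squares_def)
  moreover have "card (GF q - {0 :: 'a}) = q - 1"
    using q_pos by (simp add: card_Diff_singleton card_GF_q)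
  ultimately show "card (squares q :: 'a set) \<le> q - 1"
    using card_image_le[of "GF q - {0 :: 'a}" "\<lambda>c. c ^ 2"] by simp
  assume "odd q"
  then obtain k where k: "q = 2 * k + 1" by (rule oddE)
  have "squares q \<subseteq> {x :: 'a. x ^ k = 1}"
    using q_gt_1 by (auto simp: squares_def GF_eq_roots_of_unity k simp flip: power_mult)
  then have "card (squares q :: 'a set) \<le> card {x :: 'a. x ^ k = 1}"
    by (rule card_mono[rotated]) simp
  also have "\<dots> \<le> k" using q_gt_1 k by (intro card_power_eq_le) simp
  finally show "2 * card (squares q :: 'a set) \<le> q - 1" using k by simp
qed

theorem theorem4p15:
  fixes q d m :: nat
    and \<mu> :: "'a::{field,finite}"
    and \<T> T :: "'a set"
    and \<M> :: "('a ^ 'n::finite) set set"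
  assumes "primepow q"
    and "CARD('a) = q ^ 6"
    and "6 dvd d" and "odd (d div 6)"
    and "CARD('n) = d div 6"
    and "\<mu> \<noteq> 0" and "\<mu> + \<mu> ^ (q ^ 3) = 0"
    and "\<T> \<subseteq> GF (q ^ 3) - {0}"
    and "invariant_under (squares q) \<T>"
    and "coset_reps (squares q) \<T> T"
    and "\<M> = value_set q \<T>"
    and "m \<ge> 1"
    and "m_ovoid q (symp q \<mu>) m \<M>"
    and "invariant_under (GF q - {0}) \<T>"
  shows "(even q \<longrightarrow> card T \<ge> q) \<and> (odd q \<longrightarrow> card T \<ge> 2 * q)"
proof -
  interpret trace_form q \<mu>
    by unfold_locales (use assms in simp_all)
  have zero: "0 \<notin> \<T>" using assms(8) by auto
  have odd: "odd CARD('n)" using assms(4,5) by simp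
  have ovoid: "m_ovoid q (symp q \<mu>) m (value_set q \<T> :: ('a ^ 'n) set set)"
    using assms(11,13) by simp
  define s where "s = q ^ (3 * CARD('n) - 3)"
  have "s > 0" using q_pos by (simp add: s_def)
  have planes: "card {v \<in> \<pi>. herm q v v \<in> \<T>} * s = (q - 1) * m"
    if "totally_isotropic q (symp q \<mu>) \<pi>" "card \<pi> = q ^ 3" for \<pi> :: "('a ^ 1) set"
    unfolding s_def by (rule m_ovoid_plane_card[OF odd zero assms(14) ovoid that])
  \<comment> \<open>The division is exact by \<open>planes\<close>, and the quotient does not depend
    on the plane.\<close>
  define C where "C = (q - 1) * m div s"
  interpret constant_on_planes q \<mu> \<T> C
  proof
    show "card {v \<in> \<pi>. herm q v v \<in> \<T>} = C"
      if "totally_isotropic q (symp q \<mu>) \<pi>" "card \<pi> = q ^ 3" for \<pi> :: "('a ^ 1) set"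
      using planes[OF that, symmetric] \<open>s > 0\<close> by (simp add: C_def)
  qed (use assms in simp_all)
  \<comment> \<open>The plane spanned over \<open>GF (q ^ 3)\<close> by \<open>vec 1\<close> serves
    as an instance. With \<open>m \<ge> 1\<close> the equation forces \<open>C > 0\<close>, so
    \<open>\<T>\<close> is nonempty.\<close>
  have "C * s = (q - 1) * m"
    using planes[OF totally_isotropic_K_line, of "vec 1"]
      plane[OF totally_isotropic_K_line, of "vec 1"]
    by (simp add: card_Fq_line card_GF_q vec_eq_iff)
  moreover have "(q - 1) * m > 0" using q_gt_1 assms(12) by simp
  ultimately have "\<T> \<noteq> {}" using C_eq by auto
  then have "(q - 1) * q \<le> card (squares q :: 'a set) * card T"
    using card_\<T>_ge card_coset_reps[OF assms(9,10) zero] by (simp add: mult.commute)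
  moreover have "card (squares q :: 'a set) * card T \<le> (q - 1) * card T"
    using card_squares_le(1) by (rule mult_le_mono1)
  moreover have "2 * (card (squares q :: 'a set) * card T) \<le> (q - 1) * card T" if "odd q"
    using mult_le_mono1[OF card_squares_le(2)[OF that], of "card T"] by simp
  ultimately have "(q - 1) * q \<le> (q - 1) * card T"
    and "odd q \<Longrightarrow> (q - 1) * (2 * q) \<le> (q - 1) * card T"
    unfolding mult.left_commute[of "q - 1" 2] by linarith+
  then show ?thesis
    using q_gt_1 by simp
qed

end
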